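(* If $b^-<\hat b^-$, then $u_{b^-,b^+}\le u_{\hat b^-,b^+}$ in $\overline\Omega\times[0,\infty)$, while if $b^+<\hat b^+$, then $u_{b^-,b^+}\ge u_{b^-,\hat b^+}$ in $\overline\Omega\times[0,\infty)$.
   Context: $\Omega\subset\mathbb{R}^N$, $N\ge1$, is a bounded smooth domain and $u_0$ is a fixed continuous function on $\overline\Omega$ with $u_0|_{\partial\Omega}=0$. All pairs of parameters $(b^-,b^+)$, $(\hat b^-,b^+)$, $(b^-,\hat b^+)$ satisfy that the second entry is larger than the first one, which is positive. For $b^+>b^->0$ let $b(s)=b^-$ if $s<0$ and $b(s)=b^+$ if $s\ge0$. $u_{b^-,b^+}$ denotes the unique viscosity solution of $$b(\partial_tu)\partial_tu=\Delta u\ \text{ in }\Omega\times(0,+\infty),\quad u=0\ \text{ on }\partial\Omega\times(0,+\infty),\quad u(\cdot,0)=u_0\ \text{ in }\Omega,$$ that is, the continuous function $u:\overline\Omega\times[0,\infty)\to\mathbb{R}$ satisfying the boundary and initial conditions and such that, for every smooth $\phi$, $b(\partial_t\phi)\partial_t\phi-\Delta\phi\le0$ (resp. $\ge0$) at every local maximum (resp. minimum) point $(x_0,t_0)\in\Omega\times(0,\infty)$ of $u-\phi$. *)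

theory Defs
  imports "HOL-Analysis.Analysis"
begin

text \<open>Intended for open \<open>S\<close> only: derivatives are taken in full neighbourhoods of the points of \<open>S\<close>.\<close>

primrec Ck_on :: "nat \<Rightarrow> 'a::euclidean_space set \<Rightarrow> ('a \<Rightarrow> real) \<Rightarrow> bool" where
  "Ck_on 0 S f \<longleftrightarrow> continuous_on S f"
| "Ck_on (Suc k) S f \<longleftrightarrow>
     (\<forall>x\<in>S. f differentiable (at x)) \<and>
     (\<forall>i\<in>Basis. Ck_on k S (\<lambda>x. frechet_derivative f (at x) i))"

definition smooth_fun_on :: "'a::euclidean_space set \<Rightarrow> ('a \<Rightarrow> real) \<Rightarrow> bool" where
  "smooth_fun_on S f \<longleftrightarrow> (\<forall>k. Ck_on k S f)"

text \<open>
  Near each boundary point the set is the strict epigraph of a smooth function \<open>\<gamma>\<close> over the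
  hyperplane orthogonal to some unit vector \<open>e\<close>. To avoid choosing coordinates of that hyperplane,
  \<open>\<gamma>\<close> is defined on the whole space and evaluated only at orthogonal projections. In dimension one
  the hyperplane is \<open>{0}\<close>, and the condition says that the set is locally an open half-line.
\<close>

definition smooth_boundary :: "'a::euclidean_space set \<Rightarrow> bool" where
  "smooth_boundary \<Omega> \<longleftrightarrow>
     (\<forall>p\<in>frontier \<Omega>. \<exists>r>0. \<exists>e \<gamma>. norm e = 1 \<and> smooth_fun_on UNIV \<gamma> \<and>
        \<Omega> \<inter> ball p r = {x \<in> ball p r. x \<bullet> e > \<gamma> (x - (x \<bullet> e) *\<^sub>R e)})"

definition bounded_smooth_domain :: "'a::euclidean_space set \<Rightarrow> bool" where
  "bounded_smooth_domain \<Omega> \<longleftrightarrow>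
     open \<Omega> \<and> connected \<Omega> \<and> \<Omega> \<noteq> {} \<and> bounded \<Omega> \<and> smooth_boundary \<Omega>"

definition time_deriv :: "('a::euclidean_space \<times> real \<Rightarrow> real) \<Rightarrow> 'a \<Rightarrow> real \<Rightarrow> real" where
  "time_deriv \<phi> x t = deriv (\<lambda>s. \<phi> (x, s)) t"

definition space_laplacian :: "('a::euclidean_space \<times> real \<Rightarrow> real) \<Rightarrow> 'a \<Rightarrow> real \<Rightarrow> real" where
  "space_laplacian \<phi> x t = (\<Sum>i\<in>Basis. (deriv ^^ 2) (\<lambda>s. \<phi> (x + s *\<^sub>R i, t)) 0)"

definition b_coeff :: "real \<Rightarrow> real \<Rightarrow> real \<Rightarrow> real" where
  "b_coeff bm bp s = (if s < 0 then bm else bp)"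

definition pde_operator ::
    "real \<Rightarrow> real \<Rightarrow> ('a::euclidean_space \<times> real \<Rightarrow> real) \<Rightarrow> 'a \<Rightarrow> real \<Rightarrow> real" where
  "pde_operator bm bp \<phi> x t =
     b_coeff bm bp (time_deriv \<phi> x t) * time_deriv \<phi> x t - space_laplacian \<phi> x t"

text \<open>
  Local extrema are taken over full space-time neighbourhoods, including times after \<open>t0\<close>. Since
  \<open>\<Omega> \<times> {0<..}\<close> is open, \<open>nhds (x0, t0)\<close> does not see values outside it.
\<close>

definition viscosity_subsolution ::
    "'a::euclidean_space set \<Rightarrow> real \<Rightarrow> real \<Rightarrow> ('a \<times> real \<Rightarrow> real) \<Rightarrow> bool" where
  "viscosity_subsolution \<Omega> bm bp u \<longleftrightarrow>
     (\<forall>\<phi>. smooth_fun_on (\<Omega> \<times> {0<..}) \<phi> \<longrightarrow>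
        (\<forall>x0\<in>\<Omega>. \<forall>t0>0.
           (\<forall>\<^sub>F z in nhds (x0, t0). u z - \<phi> z \<le> u (x0, t0) - \<phi> (x0, t0)) \<longrightarrow>
           pde_operator bm bp \<phi> x0 t0 \<le> 0))"

definition viscosity_supersolution ::
    "'a::euclidean_space set \<Rightarrow> real \<Rightarrow> real \<Rightarrow> ('a \<times> real \<Rightarrow> real) \<Rightarrow> bool" where
  "viscosity_supersolution \<Omega> bm bp u \<longleftrightarrow>
     (\<forall>\<phi>. smooth_fun_on (\<Omega> \<times> {0<..}) \<phi> \<longrightarrow>
        (\<forall>x0\<in>\<Omega>. \<forall>t0>0.
           (\<forall>\<^sub>F z in nhds (x0, t0). u z - \<phi> z \<ge> u (x0, t0) - \<phi> (x0, t0)) \<longrightarrow>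
           pde_operator bm bp \<phi> x0 t0 \<ge> 0))"

text \<open>Functions are total; only the values on \<open>closure \<Omega> \<times> {0..}\<close> are constrained.\<close>

definition viscosity_solution ::
    "'a::euclidean_space set \<Rightarrow> ('a \<Rightarrow> real) \<Rightarrow> real \<Rightarrow> real \<Rightarrow> ('a \<times> real \<Rightarrow> real) \<Rightarrow> bool" where
  "viscosity_solution \<Omega> u0 bm bp u \<longleftrightarrow>
     continuous_on (closure \<Omega> \<times> {0..}) u \<and>
     (\<forall>x\<in>frontier \<Omega>. \<forall>t>0. u (x, t) = 0) \<and>
     (\<forall>x\<in>\<Omega>. u (x, 0) = u0 x) \<and>
     viscosity_subsolution \<Omega> bm bp u \<and>
     viscosity_supersolution \<Omega> bm bp u"

end

theory Submission
  imports Defs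
begin

text \<open>
  Since \<open>0 < b\<^sup>- < b\<^sup>+\<close>, the nonlinearity is a maximum of two linear functions,
  \<open>b(s) s = max (b\<^sup>- s) (b\<^sup>+ s)\<close>. Lowering \<open>b\<^sup>-\<close> or raising \<open>b\<^sup>+\<close> enlarges this maximum,
  so a supersolution stays a supersolution (\<open>supersolution_mono\<close>). Both claims therefore follow from a
  comparison principle between a subsolution \<open>u\<close> and a supersolution \<open>v\<close> for one pair of parameters
  (\<open>comparison_principle\<close>).

  The operator is convex, so comparison needs no doubling of variables. A subsolution \<open>u\<close> is a
  viscosity subsolution of both linear equations \<open>c u\<^sub>t = \<Delta>u\<close>, \<open>c = b\<^sup>-, b\<^sup>+\<close>, and for each of
  these the mollification \<open>U = \<kappa> * u\<close> is a classical subsolution (\<open>mollified_subsolution\<close>). So \<open>U\<close> is a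
  \<open>C\<^sup>2\<close> subsolution of the nonlinear equation that is uniformly close to \<open>u\<close>. If \<open>u > v\<close> somewhere,
  then \<open>U - \<psi>\<close>, with a small strictly increasing function \<open>\<psi>\<close> of time, is an admissible test function
  for \<open>v\<close> at an interior minimum of \<open>v - (U - \<psi>)\<close>, where it violates the inequality for
  supersolutions.

  The heart is \<open>mollified_subsolution\<close>. Write \<open>L = \<Delta> - c \<partial>\<^sub>t\<close>, let \<open>L\<^sub>h\<close> be its monotone
  finite-difference approximation (\<open>heat_diff\<close>), and let \<open>R\<close> be an approximation of
  \<open>\<alpha> (\<alpha> - L\<^sub>h)\<^sup>-\<^sup>1\<close> obtained by truncating its Neumann series. Then \<open>R\<close> is a finite combination of
  translations with nonnegative weights of sum at most one. If \<open>f\<close> is a smooth function close to \<open>u\<close>, then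
  \<open>W = R f\<close> is smooth and nearly solves \<open>\<alpha> W - L W = \<alpha> f\<close>. Comparing \<open>u\<close> locally with \<open>W\<close> plus a
  quartic barrier gives \<open>u \<le> R u + O(\<alpha>\<^sup>-\<^sup>2)\<close> up to an arbitrarily small error
  (\<open>resolvent_comparison\<close>). This inequality involves only values of \<open>u\<close> and is invariant under
  translation, hence it passes to the average: \<open>U \<le> R U + O(\<alpha>\<^sup>-\<^sup>2)\<close>. For the smooth function \<open>U\<close> one has
  \<open>\<alpha> (R U - U) = L U + O(\<alpha>\<^sup>-\<^sup>1)\<close>, and \<open>\<alpha> \<rightarrow> \<infinity>\<close> yields \<open>L U \<ge> 0\<close>.
\<close>

section \<open>Functions with continuous partial derivatives\<close>

text \<open>
  The derivative of \<open>f\<close> at \<open>x\<close> in the direction \<open>i\<close>, for \<open>i\<close> in the basis a partial derivative. Like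
  the Frechet derivative, it is meaningful only where \<open>f\<close> is differentiable.
\<close>

definition pd :: "'a::euclidean_space \<Rightarrow> ('a \<Rightarrow> real) \<Rightarrow> 'a \<Rightarrow> real" where
  "pd i f x = frechet_derivative f (at x) i"

abbreviation Ck :: "nat \<Rightarrow> ('a::euclidean_space \<Rightarrow> real) \<Rightarrow> bool" where
  "Ck k f \<equiv> Ck_on k UNIV f"

lemma Ck_Suc_iff:
  "Ck (Suc k) f \<longleftrightarrow> (\<forall>x. f differentiable (at x)) \<and> (\<forall>i\<in>Basis. Ck k (pd i f))"
  by (simp add: Ck_on.simps(2) pd_def[abs_def])

declare Ck_on.simps(2) [simp del]

lemma pd_eqI: "(f has_derivative f') (at x) \<Longrightarrow> pd i f x = f' i"
  unfolding pd_def by (metis frechet_derivative_at)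

lemma has_derivative_pd:
  "f differentiable (at x) \<Longrightarrow> (f has_derivative (\<lambda>d. pd d f x)) (at x)"
  unfolding pd_def by (metis frechet_derivative_works)

lemma pd_expand:
  assumes "f differentiable (at x)"
  shows "pd d f x = (\<Sum>i\<in>Basis. (d \<bullet> i) * pd i f x)"
proof -
  interpret linear "\<lambda>d. pd d f x"
    using has_derivative_pd[OF assms] has_derivative_linear by blast
  have "pd d f x = pd (\<Sum>i\<in>Basis. (d \<bullet> i) *\<^sub>R i) f x" by (simp add: euclidean_representation)
  also have "\<dots> = (\<Sum>i\<in>Basis. (d \<bullet> i) * pd i f x)" by (simp add: sum scale)
  finally show ?thesis .
qed

lemma Ck_Suc_imp_Ck: "Ck (Suc k) f \<Longrightarrow> Ck k f"
proof (induction k arbitrary: f)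
  case 0
  then show ?case
    by (auto simp: Ck_Suc_iff intro!: continuous_at_imp_continuous_on differentiable_imp_continuous_within)
next
  case (Suc k)
  then show ?case by (metis Ck_Suc_iff)
qed

lemma Ck_le: "Ck m f \<Longrightarrow> k \<le> m \<Longrightarrow> Ck k f"
  by (induction m) (auto simp: le_Suc_eq intro: Ck_Suc_imp_Ck)

lemma Ck_Suc_D:
  assumes "Ck (Suc k) f"
  shows "f differentiable (at x)" "i \<in> Basis \<Longrightarrow> Ck k (pd i f)"
  using assms unfolding Ck_Suc_iff by auto

lemma Ck_continuous: "Ck k f \<Longrightarrow> continuous_on UNIV f"
  using Ck_le[of k f 0] by simp

lemma Ck_pos_differentiable: "Ck k f \<Longrightarrow> 0 < k \<Longrightarrow> f differentiable (at x)"
  by (cases k) (auto simp: Ck_Suc_iff)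

lemma pd_const: "pd i (\<lambda>x. c) = (\<lambda>x. 0)"
  by (rule ext, rule pd_eqI) (rule has_derivative_const)

lemma pd_inner: "pd i (\<lambda>x. x \<bullet> e) = (\<lambda>x. i \<bullet> e)"
  by (rule ext, rule pd_eqI) (auto intro!: derivative_eq_intros)

lemma pd_add:
  assumes "\<And>x. f differentiable (at x)" "\<And>x. g differentiable (at x)"
  shows "pd i (\<lambda>x. f x + g x) = (\<lambda>x. pd i f x + pd i g x)"
  by (rule ext, rule pd_eqI) (rule has_derivative_add[OF has_derivative_pd has_derivative_pd], rule assms, rule assms)

lemma pd_mult:
  assumes "\<And>x. f differentiable (at x)" "\<And>x. g differentiable (at x)"
  shows "pd i (\<lambda>x. f x * g x) = (\<lambda>x. f x * pd i g x + pd i f x * g x)"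
  by (rule ext, rule pd_eqI) (rule has_derivative_mult[OF has_derivative_pd has_derivative_pd], rule assms, rule assms)

lemma pd_cmult:
  assumes "\<And>x. f differentiable (at x)"
  shows "pd i (\<lambda>x. c * f x) = (\<lambda>x. c * pd i f x)"
  by (subst pd_mult) (auto simp: pd_const assms)

lemma pd_translate:
  assumes "\<And>x. f differentiable (at x)"
  shows "pd i (\<lambda>x. f (x + y)) = (\<lambda>x. pd i f (x + y))"
proof (rule ext, rule pd_eqI)
  fix x
  have "((\<lambda>x. x + y) has_derivative (\<lambda>d. d)) (at x)"
    by (auto intro!: derivative_eq_intros)
  from has_derivative_compose[OF this has_derivative_pd[OF assms]]
  show "((\<lambda>x. f (x + y)) has_derivative (\<lambda>d. pd d f (x + y))) (at x)" by simp
qed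

lemma Ck_const [simp]: "Ck k (\<lambda>x. c)"
proof (induction k arbitrary: c)
  case (Suc k)
  then show ?case unfolding Ck_Suc_iff by (simp add: pd_const)
qed simp

lemma Ck_inner [simp]: "Ck k (\<lambda>x. x \<bullet> e)"
proof (cases k)
  case 0
  then show ?thesis by (simp add: continuous_on_inner continuous_on_id)
next
  case (Suc l)
  have "(\<lambda>x. x \<bullet> e) differentiable (at x)" for x
    using bounded_linear_imp_differentiable bounded_linear_inner_left by blast
  then show ?thesis unfolding Suc Ck_Suc_iff by (simp add: pd_inner)
qed

lemma Ck_add: "Ck k f \<Longrightarrow> Ck k g \<Longrightarrow> Ck k (\<lambda>x. f x + g x)"
proof (induction k arbitrary: f g)
  case (Suc k)
  then show ?case unfolding Ck_Suc_iff by (simp add: pd_add)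
qed (simp add: continuous_on_add)

lemma Ck_mult: "Ck k f \<Longrightarrow> Ck k g \<Longrightarrow> Ck k (\<lambda>x. f x * g x)"
proof (induction k arbitrary: f g)
  case (Suc k)
  have *: "Ck k f" "Ck k g" using Suc.prems Ck_Suc_imp_Ck by blast+
  show ?case using Suc.prems Suc.IH * unfolding Ck_Suc_iff
    by (simp add: pd_mult Ck_add)
qed (simp add: continuous_on_mult)

lemma Ck_cmult: "Ck k f \<Longrightarrow> Ck k (\<lambda>x. c * f x)"
  by (rule Ck_mult) simp_all

lemma Ck_diff: "Ck k f \<Longrightarrow> Ck k g \<Longrightarrow> Ck k (\<lambda>x. f x - g x)"
  using Ck_add[of k f "\<lambda>x. (-1) * g x"] Ck_cmult[of k g "-1"] by simp

lemma Ck_power: "Ck k f \<Longrightarrow> Ck k (\<lambda>x. f x ^ m)"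
  by (induction m) (auto intro: Ck_mult)

lemma Ck_sum: "(\<And>i. i \<in> I \<Longrightarrow> Ck k (f i)) \<Longrightarrow> Ck k (\<lambda>x. \<Sum>i\<in>I. f i x)"
  by (induction I rule: infinite_finite_induct) (auto intro: Ck_add)

lemma Ck_translate: "Ck k f \<Longrightarrow> Ck k (\<lambda>x. f (x + y))"
proof (induction k arbitrary: f)
  case 0
  then show ?case
    using continuous_on_compose2[of UNIV f UNIV "\<lambda>x. x + y"] by (simp add: continuous_intros)
next
  case (Suc k)
  have d: "(\<lambda>x. f (x + y)) differentiable (at x)" for x
  proof -
    have "(\<lambda>x. x + y) differentiable (at x)" by simp
    moreover have "f differentiable (at (x + y))" using Suc.prems by (rule Ck_Suc_D)
    ultimately show ?thesis
      using differentiable_chain_at[of "\<lambda>x. x + y" x f] by (simp add: o_def)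
  qed
  show ?case using Suc.prems Suc.IH d unfolding Ck_Suc_iff by (simp add: pd_translate)
qed

lemma Ck_norm_sq: "Ck k (\<lambda>x. (x - a) \<bullet> (x - a))"
proof -
  have "Ck k (\<lambda>x. \<Sum>i\<in>Basis. (x \<bullet> i - a \<bullet> i) * (x \<bullet> i - a \<bullet> i))"
    by (intro Ck_sum Ck_mult Ck_diff) simp_all
  then show ?thesis by (subst euclidean_inner) (simp add: inner_diff_left)
qed

lemma Ck_on_subset: "Ck_on k S f \<Longrightarrow> T \<subseteq> S \<Longrightarrow> Ck_on k T f"
  by (induction k arbitrary: f) (auto simp: Ck_on.simps(2) intro: continuous_on_subset)

lemma line_derivative:
  assumes "\<And>x. f differentiable (at x)"
  shows "((\<lambda>s. f (z + s *\<^sub>R d)) has_real_derivative pd d f (z + s *\<^sub>R d)) (at s)"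
proof -
  have "((\<lambda>s. z + s *\<^sub>R d) has_derivative (\<lambda>h. h *\<^sub>R d)) (at s)"
    by (auto intro!: derivative_eq_intros)
  from has_derivative_compose[OF this has_derivative_pd[OF assms]]
  have "((\<lambda>s. f (z + s *\<^sub>R d)) has_derivative (\<lambda>h. pd (h *\<^sub>R d) f (z + s *\<^sub>R d))) (at s)" .
  moreover have "pd (h *\<^sub>R d) f (z + s *\<^sub>R d) = pd d f (z + s *\<^sub>R d) * h" for h
    by (subst (1 2) pd_expand[OF assms]) (simp add: sum_distrib_left mult_ac)
  ultimately show ?thesis by (simp add: has_field_derivative_def)
qed

lemma Taylor_second_1D:
  fixes g :: "real \<Rightarrow> real"
  assumes "\<And>s. (g has_real_derivative g' s) (at s)"
    and "\<And>s. (g' has_real_derivative g'' s) (at s)" and "0 < h"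
  shows "\<exists>t. 0 < t \<and> t < h \<and> g h = g 0 + g' 0 * h + g'' t / 2 * h\<^sup>2"
proof -
  define D where "D = (\<lambda>m::nat. if m = 0 then g else if m = 1 then g' else g'')"
  have "\<exists>t>0. t < h \<and> g h = (\<Sum>m<2. D m 0 / fact m * h ^ m) + D 2 t / fact 2 * h ^ 2"
    by (rule Maclaurin) (use assms in \<open>auto simp: D_def less_2_cases_iff\<close>)
  then show ?thesis by (simp add: D_def numeral_2_eq_2)
qed

lemma Taylor_second_along:
  assumes "Ck 2 f"
  shows "\<exists>t. 0 < t \<and> t < 1 \<and> f (z + d) = f z + (\<Sum>i\<in>Basis. (d \<bullet> i) * pd i f z)
     + (\<Sum>i\<in>Basis. \<Sum>j\<in>Basis. (d \<bullet> i) * (d \<bullet> j) * pd j (pd i f) (z + t *\<^sub>R d)) / 2"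
proof -
  have f: "\<And>x. f differentiable (at x)" and f': "\<And>i x. i \<in> Basis \<Longrightarrow> pd i f differentiable (at x)"
    using assms unfolding numeral_2_eq_2 by (meson Ck_Suc_D)+
  define g' where "g' = (\<lambda>s. \<Sum>i\<in>Basis. (d \<bullet> i) * pd i f (z + s *\<^sub>R d))"
  define g'' where "g'' = (\<lambda>s. \<Sum>i\<in>Basis. (d \<bullet> i) * (\<Sum>j\<in>Basis. (d \<bullet> j) * pd j (pd i f) (z + s *\<^sub>R d)))"
  have 1: "((\<lambda>s. f (z + s *\<^sub>R d)) has_real_derivative g' s) (at s)" for s
    using line_derivative[OF f, of z d s] unfolding g'_def by (subst (asm) pd_expand[OF f])
  have 2: "(g' has_real_derivative g'' s) (at s)" for s
    unfolding g'_def g''_def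
  proof (intro DERIV_sum DERIV_cmult)
    fix i :: 'a assume i: "i \<in> Basis"
    show "((\<lambda>s. pd i f (z + s *\<^sub>R d)) has_real_derivative (\<Sum>j\<in>Basis. (d \<bullet> j) * pd j (pd i f) (z + s *\<^sub>R d))) (at s)"
      using line_derivative[OF f'[OF i], of z d s] by (subst (asm) pd_expand[OF f'[OF i]])
  qed
  from Taylor_second_1D[OF 1 2, of 1] show ?thesis
    by (auto simp: g'_def g''_def sum_distrib_left mult_ac)
qed

section \<open>Second-order Taylor expansion and viscosity tests with \<open>C\<^sup>2\<close> functions\<close>

lemma sum_Basis_square: "(\<Sum>i\<in>Basis. \<bar>d \<bullet> i\<bar>) * (\<Sum>j\<in>Basis. \<bar>d \<bullet> j\<bar>) \<le> real DIM('a) ^ 2 * ((d::'a::euclidean_space) \<bullet> d)"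
proof -
  have "(\<Sum>i\<in>Basis. \<bar>d \<bullet> i\<bar>) \<le> real DIM('a) * norm d"
    using sum_bounded_above[of Basis "\<lambda>i. \<bar>d \<bullet> i\<bar>" "norm d"] by (simp add: Basis_le_norm)
  then have "(\<Sum>i\<in>Basis. \<bar>d \<bullet> i\<bar>)\<^sup>2 \<le> (real DIM('a) * norm d)\<^sup>2"
    by (intro power_mono) (auto intro: sum_nonneg)
  then show ?thesis by (simp add: power2_eq_square power_mult_distrib dot_square_norm mult_ac)
qed

text \<open>
  Only continuity of the second partial derivatives is used; their symmetry is not needed.
\<close>

lemma Taylor_second_local:
  fixes f :: "'a::euclidean_space \<Rightarrow> real"
  assumes f: "Ck 2 f" and \<delta>: "0 < \<delta>"
  shows "\<exists>r>0. \<forall>d. norm d < r \<longrightarrow>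
    \<bar>f (z + d) - (f z + (\<Sum>i\<in>Basis. (d \<bullet> i) * pd i f z)
        + (\<Sum>i\<in>Basis. \<Sum>j\<in>Basis. (d \<bullet> i) * (d \<bullet> j) * pd j (pd i f) z) / 2)\<bar> \<le> \<delta> * (d \<bullet> d)"
proof -
  define \<eta> where "\<eta> = \<delta> / real DIM('a) ^ 2"
  have \<eta>: "0 < \<eta>" using \<delta> by (simp add: \<eta>_def)
  have cont: "isCont (pd j (pd i f)) z" if "i \<in> Basis" "j \<in> Basis" for i j
  proof -
    have "Ck 0 (pd j (pd i f))" using f that unfolding numeral_2_eq_2 by (intro Ck_Suc_D) auto
    then show ?thesis by (simp add: continuous_on_eq_continuous_at)
  qed
  have "\<forall>\<^sub>F w in at z. \<forall>i\<in>Basis. \<forall>j\<in>Basis. dist (pd j (pd i f) w) (pd j (pd i f) z) < \<eta>"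
    using cont \<eta> by (intro eventually_ball_finite ballI) (auto simp: isCont_def tendsto_iff)
  then obtain r where r: "r > 0" and
    *: "\<And>w i j. \<lbrakk>w \<noteq> z; dist w z < r; i \<in> Basis; j \<in> Basis\<rbrakk> \<Longrightarrow> \<bar>pd j (pd i f) w - pd j (pd i f) z\<bar> < \<eta>"
    unfolding eventually_at dist_real_def by auto
  have **: "\<bar>pd j (pd i f) w - pd j (pd i f) z\<bar> \<le> \<eta>" if "dist w z < r" "i \<in> Basis" "j \<in> Basis" for w i j
    using *[of w i j] that \<eta> by (cases "w = z") auto
  show ?thesis
  proof (intro exI conjI allI impI)
    show "0 < r" by fact
    fix d :: 'a assume d: "norm d < r"
    obtain t where t: "0 < t" "t < 1" and T: "f (z + d) = f z + (\<Sum>i\<in>Basis. (d \<bullet> i) * pd i f z)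
     + (\<Sum>i\<in>Basis. \<Sum>j\<in>Basis. (d \<bullet> i) * (d \<bullet> j) * pd j (pd i f) (z + t *\<^sub>R d)) / 2"
      using Taylor_second_along[OF f] by blast
    have near: "dist (z + t *\<^sub>R d) z < r"
      using mult_left_le_one_le[of "norm d" t] t d by (simp add: dist_norm)
    have "\<bar>f (z + d) - (f z + (\<Sum>i\<in>Basis. (d \<bullet> i) * pd i f z)
        + (\<Sum>i\<in>Basis. \<Sum>j\<in>Basis. (d \<bullet> i) * (d \<bullet> j) * pd j (pd i f) z) / 2)\<bar>
      = \<bar>\<Sum>i\<in>Basis. \<Sum>j\<in>Basis. (d \<bullet> i) * (d \<bullet> j) * (pd j (pd i f) (z + t *\<^sub>R d) - pd j (pd i f) z)\<bar> / 2"
      unfolding T by (simp add: right_diff_distrib sum_subtractf diff_divide_distrib[symmetric])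
    also have "\<dots> \<le> (\<Sum>i\<in>Basis. \<Sum>j\<in>Basis. \<bar>d \<bullet> i\<bar> * \<bar>d \<bullet> j\<bar> * \<eta>) / 2"
      by (intro divide_right_mono order_trans[OF sum_abs] sum_mono)
         (auto simp: abs_mult intro!: mult_left_mono ** near)
    also have "\<dots> = \<eta> / 2 * ((\<Sum>i\<in>Basis. \<bar>d \<bullet> i\<bar>) * (\<Sum>j\<in>Basis. \<bar>d \<bullet> j\<bar>))"
      unfolding sum_product by (simp add: sum_distrib_left mult_ac)
    also have "\<dots> \<le> \<eta> / 2 * (real DIM('a) ^ 2 * (d \<bullet> d))"
      using \<eta> by (intro mult_left_mono sum_Basis_square) auto
    also have "\<dots> = \<delta> / 2 * (d \<bullet> d)" by (simp add: \<eta>_def)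
    also have "\<dots> \<le> \<delta> * (d \<bullet> d)" using \<delta> by (intro mult_right_mono) auto
    finally show "\<bar>f (z + d) - (f z + (\<Sum>i\<in>Basis. (d \<bullet> i) * pd i f z)
        + (\<Sum>i\<in>Basis. \<Sum>j\<in>Basis. (d \<bullet> i) * (d \<bullet> j) * pd j (pd i f) z) / 2)\<bar> \<le> \<delta> * (d \<bullet> d)" .
  qed
qed

text \<open>
  The Laplacian in the space variables, as an iterated partial derivative.
\<close>

definition xlap :: "('x::euclidean_space \<times> real \<Rightarrow> real) \<Rightarrow> 'x \<times> real \<Rightarrow> real" where
  "xlap f z = (\<Sum>i\<in>Basis. pd (i, 0) (pd (i, 0) f) z)"

text \<open>
  The second-order Taylor polynomial of \<open>f\<close> at \<open>z\<close> with an extra term \<open>\<sigma> |w - z|\<^sup>2\<close>. For \<open>\<sigma> > 0\<close> it touches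
  \<open>f\<close> at \<open>z\<close> from above, for \<open>\<sigma> < 0\<close> from below, and being a polynomial it is smooth.
\<close>

definition quad :: "real \<Rightarrow> ('a::euclidean_space \<Rightarrow> real) \<Rightarrow> 'a \<Rightarrow> 'a \<Rightarrow> real" where
  "quad \<sigma> f z w = f z + (\<Sum>i\<in>Basis. ((w - z) \<bullet> i) * pd i f z)
     + (\<Sum>i\<in>Basis. \<Sum>j\<in>Basis. ((w - z) \<bullet> i) * ((w - z) \<bullet> j) * pd j (pd i f) z) / 2
     + \<sigma> * ((w - z) \<bullet> (w - z))"

lemma Ck_quad: "Ck k (quad \<sigma> f z)"
proof -
  have l: "Ck k (\<lambda>w. (w - z) \<bullet> i)" for i
    by (simp add: inner_diff_left Ck_diff)
  have "Ck k (\<lambda>w. f z + (\<Sum>i\<in>Basis. ((w - z) \<bullet> i) * pd i f z)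
     + (1/2) * (\<Sum>i\<in>Basis. \<Sum>j\<in>Basis. ((w - z) \<bullet> i) * ((w - z) \<bullet> j) * pd j (pd i f) z)
     + \<sigma> * ((w - z) \<bullet> (w - z)))"
    by (intro Ck_add Ck_sum Ck_mult l Ck_norm_sq Ck_const)
  then show ?thesis unfolding quad_def[abs_def] by simp
qed

lemma quad_along:
  assumes "e \<in> Basis"
  shows "quad \<sigma> f z (z + s *\<^sub>R e) = f z + pd e f z * s + (pd e (pd e f) z / 2 + \<sigma>) * s\<^sup>2"
proof -
  have i: "(s *\<^sub>R e) \<bullet> i = (if i = e then s else 0)" if "i \<in> Basis" for i
    using that assms by (auto simp: inner_Basis)
  have "(\<Sum>i\<in>Basis. \<Sum>j\<in>Basis. ((s *\<^sub>R e) \<bullet> i) * ((s *\<^sub>R e) \<bullet> j) * pd j (pd i f) z)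
     = (\<Sum>i\<in>Basis. \<Sum>j\<in>Basis. if i = e then (if j = e then s * s * pd e (pd e f) z else 0) else 0)"
    by (intro sum.cong) (auto simp: i simp del: inner_scaleR_left)
  also have "\<dots> = (\<Sum>i\<in>Basis. if i = e then s * s * pd e (pd e f) z else 0)"
    using assms by (intro sum.cong) auto
  also have "\<dots> = s * s * pd e (pd e f) z" using assms by simp
  finally have 2: "(\<Sum>i\<in>Basis. \<Sum>j\<in>Basis. ((s *\<^sub>R e) \<bullet> i) * ((s *\<^sub>R e) \<bullet> j) * pd j (pd i f) z) = s * s * pd e (pd e f) z" .
  have "(\<Sum>i\<in>Basis. ((s *\<^sub>R e) \<bullet> i) * pd i f z) = (\<Sum>i\<in>Basis. if i = e then s * pd e f z else 0)"
    by (intro sum.cong) (auto simp: i simp del: inner_scaleR_left)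
  also have "\<dots> = s * pd e f z" using assms by simp
  finally have 1: "(\<Sum>i\<in>Basis. ((s *\<^sub>R e) \<bullet> i) * pd i f z) = s * pd e f z" .
  have 3: "(s *\<^sub>R e) \<bullet> (s *\<^sub>R e) = s\<^sup>2" using assms by (simp add: power2_eq_square)
  show ?thesis unfolding quad_def add_diff_cancel_left' 1 2 3
    by (simp add: power2_eq_square algebra_simps)
qed

lemma deriv_quadratic: "deriv (\<lambda>s. a + b * s + c * s\<^sup>2) = (\<lambda>s::real. b + 2 * c * s)"
  by (rule ext, rule DERIV_imp_deriv) (auto intro!: derivative_eq_intros)

lemma deriv2_quadratic: "(deriv ^^ 2) (\<lambda>s. a + b * s + c * s\<^sup>2) 0 = (2 * c :: real)"
proof -
  have "deriv (\<lambda>s. b + 2 * c * s) 0 = 2 * c"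
    by (rule DERIV_imp_deriv) (auto intro!: derivative_eq_intros)
  moreover have "(deriv ^^ 2) (\<lambda>s. a + b * s + c * s\<^sup>2) = deriv (deriv (\<lambda>s. a + b * s + c * s\<^sup>2))"
    unfolding numeral_2_eq_2 funpow.simps o_apply id_apply by (rule refl)
  ultimately show ?thesis unfolding deriv_quadratic by simp
qed

lemma time_deriv_quad: "time_deriv (quad \<sigma> f (x, t)) x t = pd (0, 1) f (x, t)"
proof -
  have e: "(0, 1) \<in> (Basis :: ('a \<times> real) set)" by (simp add: Basis_prod_def)
  have "quad \<sigma> f (x, t) (x, s) = f (x, t) + pd (0,1) f (x, t) * (s - t)
      + (pd (0,1) (pd (0,1) f) (x, t) / 2 + \<sigma>) * (s - t)\<^sup>2" for s
    using quad_along[OF e, of \<sigma> f "(x, t)" "s - t"] by simp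
  then show ?thesis unfolding time_deriv_def
    by simp (rule DERIV_imp_deriv, auto intro!: derivative_eq_intros)
qed

lemma space_laplacian_quad:
  "space_laplacian (quad \<sigma> f (x, t)) x t = xlap f (x, t) + 2 * \<sigma> * real DIM('a)"
  for x :: "'a::euclidean_space"
proof -
  have "(deriv ^^ 2) (\<lambda>s. quad \<sigma> f (x, t) (x + s *\<^sub>R i, t)) 0 = pd (i, 0) (pd (i, 0) f) (x, t) + 2 * \<sigma>"
    if "i \<in> Basis" for i
  proof -
    have e: "(i, 0) \<in> (Basis :: ('a \<times> real) set)" using that by (simp add: Basis_prod_def)
    show ?thesis
      using quad_along[OF e, of \<sigma> f "(x, t)"] deriv2_quadratic by (simp add: deriv2_quadratic)
  qed
  then show ?thesis unfolding space_laplacian_def xlap_def by (simp add: sum.distrib)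
qed

lemma quad_touch:
  assumes "Ck 2 f" "0 < \<delta>"
  shows "\<forall>\<^sub>F w in nhds z. quad (-\<delta>) f z w \<le> f w \<and> f w \<le> quad \<delta> f z w"
proof -
  obtain r where r: "r > 0" and *: "\<And>d. norm d < r \<Longrightarrow>
    \<bar>f (z + d) - (f z + (\<Sum>i\<in>Basis. (d \<bullet> i) * pd i f z)
        + (\<Sum>i\<in>Basis. \<Sum>j\<in>Basis. (d \<bullet> i) * (d \<bullet> j) * pd j (pd i f) z) / 2)\<bar> \<le> \<delta> * (d \<bullet> d)"
    using Taylor_second_local[OF assms] by blast
  show ?thesis
    unfolding eventually_nhds_metric
  proof (intro exI conjI allI impI)
    fix w assume "dist w z < r"
    then have "norm (w - z) < r" by (simp add: dist_norm)
    from *[OF this] show "quad (-\<delta>) f z w \<le> f w" "f w \<le> quad \<delta> f z w"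
      unfolding quad_def by (auto simp: abs_le_iff)
  qed fact
qed

lemma quad_self: "quad \<sigma> f z z = f z" by (simp add: quad_def)

lemma pde_operator_quad:
  "pde_operator bm bp (quad \<sigma> f (x, t)) x t =
     b_coeff bm bp (pd (0, 1) f (x, t)) * pd (0, 1) f (x, t) - xlap f (x, t) - 2 * \<sigma> * real DIM('a)"
  for x :: "'a::euclidean_space"
  by (simp add: pde_operator_def time_deriv_quad space_laplacian_quad)

text \<open>
  Test functions of class \<open>C\<^sup>2\<close> may be used instead of smooth ones: the polynomial \<open>quad \<delta> \<phi>\<close> touches as well, and
  its Laplacian at the contact point exceeds that of \<open>\<phi>\<close> by a multiple of \<open>\<delta>\<close> only.
\<close>

lemma subsolution_test_C2:
  fixes \<Omega> :: "'a::euclidean_space set"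
  assumes u: "viscosity_subsolution \<Omega> bm bp u" and \<phi>: "Ck 2 \<phi>" and x: "x \<in> \<Omega>" and t: "0 < t"
    and max: "\<forall>\<^sub>F z in nhds (x, t). u z - \<phi> z \<le> u (x, t) - \<phi> (x, t)"
  shows "b_coeff bm bp (pd (0, 1) \<phi> (x, t)) * pd (0, 1) \<phi> (x, t) \<le> xlap \<phi> (x, t)"
proof (rule field_le_epsilon)
  fix e :: real assume e: "0 < e"
  define \<delta> where "\<delta> = e / (2 * real DIM('a))"
  have \<delta>: "0 < \<delta>" using e by (simp add: \<delta>_def)
  have "\<forall>\<^sub>F z in nhds (x, t). u z - quad \<delta> \<phi> (x, t) z \<le> u (x, t) - quad \<delta> \<phi> (x, t) (x, t)"
    using max quad_touch[OF \<phi> \<delta>, of "(x, t)"] by eventually_elim (auto simp: quad_self)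
  moreover have "smooth_fun_on (\<Omega> \<times> {0<..}) (quad \<delta> \<phi> (x, t))"
    unfolding smooth_fun_on_def using Ck_on_subset[OF Ck_quad] by blast
  ultimately have "pde_operator bm bp (quad \<delta> \<phi> (x, t)) x t \<le> 0"
    using u x t unfolding viscosity_subsolution_def by blast
  then show "b_coeff bm bp (pd (0, 1) \<phi> (x, t)) * pd (0, 1) \<phi> (x, t) \<le> xlap \<phi> (x, t) + e"
    unfolding pde_operator_quad by (simp add: \<delta>_def)
qed

lemma supersolution_test_C2:
  fixes \<Omega> :: "'a::euclidean_space set"
  assumes u: "viscosity_supersolution \<Omega> bm bp u" and \<phi>: "Ck 2 \<phi>" and x: "x \<in> \<Omega>" and t: "0 < t"
    and max: "\<forall>\<^sub>F z in nhds (x, t). u z - \<phi> z \<ge> u (x, t) - \<phi> (x, t)"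
  shows "xlap \<phi> (x, t) \<le> b_coeff bm bp (pd (0, 1) \<phi> (x, t)) * pd (0, 1) \<phi> (x, t)"
proof (rule field_le_epsilon)
  fix e :: real assume e: "0 < e"
  define \<delta> where "\<delta> = e / (2 * real DIM('a))"
  have \<delta>: "0 < \<delta>" using e by (simp add: \<delta>_def)
  have "\<forall>\<^sub>F z in nhds (x, t). u z - quad (-\<delta>) \<phi> (x, t) z \<ge> u (x, t) - quad (-\<delta>) \<phi> (x, t) (x, t)"
    using max quad_touch[OF \<phi> \<delta>, of "(x, t)"] by eventually_elim (auto simp: quad_self)
  moreover have "smooth_fun_on (\<Omega> \<times> {0<..}) (quad (-\<delta>) \<phi> (x, t))"
    unfolding smooth_fun_on_def using Ck_on_subset[OF Ck_quad] by blast
  ultimately have "pde_operator bm bp (quad (-\<delta>) \<phi> (x, t)) x t \<ge> 0"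
    using u x t unfolding viscosity_supersolution_def by blast
  then show "xlap \<phi> (x, t) \<le> b_coeff bm bp (pd (0, 1) \<phi> (x, t)) * pd (0, 1) \<phi> (x, t) + e"
    unfolding pde_operator_quad by (simp add: \<delta>_def)
qed

section \<open>Averages of translates and the discrete heat resolvent\<close>

text \<open>
  Finite nonnegative combinations of translations \<open>g \<mapsto> (\<Sum>k. a\<^sub>k g(\<cdot> + y\<^sub>k))\<close>. The first argument is the total weight
  \<open>\<Sum>k. a\<^sub>k\<close>. Such operators are monotone and commute with everything that is linear and
  translation invariant.
\<close>

inductive transl_comb :: "real \<Rightarrow> (('a::euclidean_space \<Rightarrow> real) \<Rightarrow> 'a \<Rightarrow> real) \<Rightarrow> bool" where
  transl_comb_zero: "transl_comb 0 (\<lambda>g z. 0)"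
| transl_comb_step: "transl_comb w E \<Longrightarrow> 0 \<le> a \<Longrightarrow> transl_comb (w + a) (\<lambda>g z. E g z + a * g (z + y))"

lemma transl_comb_add: "transl_comb w' E' \<Longrightarrow> transl_comb w E \<Longrightarrow> transl_comb (w + w') (\<lambda>g z. E g z + E' g z)"
proof (induction rule: transl_comb.induct)
  case (transl_comb_step w' E' a y)
  from transl_comb.transl_comb_step[OF transl_comb_step.IH[OF transl_comb_step.prems] transl_comb_step.hyps(2), of y]
  show ?case by (simp add: add.assoc)
qed simp

lemma transl_comb_scale: "transl_comb w E \<Longrightarrow> 0 \<le> b \<Longrightarrow> transl_comb (b * w) (\<lambda>g z. b * E g z)"
proof (induction rule: transl_comb.induct)
  case (transl_comb_step w E a y)
  from transl_comb.transl_comb_step[OF transl_comb_step.IH[OF transl_comb_step.prems], of "b * a" y] transl_comb_step.hyps(2) transl_comb_step.prems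
  show ?case by (simp add: algebra_simps)
qed (simp add: transl_comb_zero)

lemma transl_comb_translate: "transl_comb w E \<Longrightarrow> transl_comb w (\<lambda>g z. E g (z + v))"
proof (induction rule: transl_comb.induct)
  case (transl_comb_step w E a y)
  from transl_comb.transl_comb_step[OF transl_comb_step.IH transl_comb_step.hyps(2), of "v + y"]
  show ?case by (simp add: add.assoc)
qed (simp add: transl_comb_zero)

lemma transl_comb_shift: "transl_comb 1 (\<lambda>g z. g (z + y))"
  using transl_comb_step[OF transl_comb_zero, of 1 y] by simp

lemma transl_comb_id: "transl_comb 1 (\<lambda>g z. g z)"
  using transl_comb_shift[of 0] by simp

lemma transl_comb_compose: "transl_comb w E \<Longrightarrow> transl_comb w' E' \<Longrightarrow> transl_comb (w * w') (\<lambda>g. E (E' g))"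
proof (induction rule: transl_comb.induct)
  case (transl_comb_step w E a y)
  from transl_comb_add[OF transl_comb_scale[OF transl_comb_translate[OF transl_comb_step.prems] transl_comb_step.hyps(2), of y] transl_comb_step.IH[OF transl_comb_step.prems]]
  show ?case by (simp add: distrib_right)
qed (simp add: transl_comb_zero)

lemma transl_comb_sum:
  "finite I \<Longrightarrow> (\<And>i. i \<in> I \<Longrightarrow> transl_comb (w i) (E i)) \<Longrightarrow> transl_comb (\<Sum>i\<in>I. w i) (\<lambda>g z. \<Sum>i\<in>I. E i g z)"
proof (induction I rule: finite_induct)
  case (insert i I)
  then show ?case using transl_comb_add[of "\<Sum>i\<in>I. w i" "\<lambda>g z. \<Sum>i\<in>I. E i g z" "w i" "E i"] by simp
qed (simp add: transl_comb_zero)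

lemma transl_comb_mass_nonneg: "transl_comb w E \<Longrightarrow> 0 \<le> w"
  by (induction rule: transl_comb.induct) auto

lemma transl_comb_bound: "transl_comb w E \<Longrightarrow> (\<And>z. \<bar>g z\<bar> \<le> m) \<Longrightarrow> \<bar>E g z\<bar> \<le> w * m"
proof (induction arbitrary: z rule: transl_comb.induct)
  case (transl_comb_step w E a y)
  have "\<bar>E g z + a * g (z + y)\<bar> \<le> \<bar>E g z\<bar> + a * \<bar>g (z + y)\<bar>"
    using transl_comb_step.hyps(2) by (metis abs_mult abs_of_nonneg abs_triangle_ineq)
  also have "\<dots> \<le> w * m + a * m"
    using transl_comb_step by (intro add_mono mult_left_mono) auto
  finally show ?case by (simp add: distrib_right)
qed simp

lemma transl_comb_bound_le1: "transl_comb w E \<Longrightarrow> w \<le> 1 \<Longrightarrow> (\<And>z. \<bar>g z\<bar> \<le> m) \<Longrightarrow> \<bar>E g z\<bar> \<le> m"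
  using transl_comb_bound[of w E g m z] mult_left_le_one_le[of m w] transl_comb_mass_nonneg[of w E]
  by (smt (verit) abs_ge_zero)

lemma transl_comb_linear: "transl_comb w E \<Longrightarrow> E (\<lambda>z. a * g z + b * h z) z = a * E g z + b * E h z"
  by (induction arbitrary: z rule: transl_comb.induct) (auto simp: algebra_simps)

lemma transl_comb_diff: "transl_comb w E \<Longrightarrow> E (\<lambda>z. g z - h z) z = E g z - E h z"
  using transl_comb_linear[of w E 1 g "-1" h z] by simp

lemma transl_comb_plus: "transl_comb w E \<Longrightarrow> E (\<lambda>z. g z + h z) z = E g z + E h z"
  using transl_comb_linear[of w E 1 g "1" h z] by simp

lemma transl_comb_cmult: "transl_comb w E \<Longrightarrow> E (\<lambda>z. a * g z) z = a * E g z"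
  using transl_comb_linear[of w E a g 0 g z] by simp

lemma transl_comb_const: "transl_comb w E \<Longrightarrow> E (\<lambda>z. a) z = w * a"
  by (induction arbitrary: z rule: transl_comb.induct) (auto simp: algebra_simps)

lemma transl_comb_sum_arg: "transl_comb w E \<Longrightarrow> E (\<lambda>z. \<Sum>i\<in>I. g i z) z = (\<Sum>i\<in>I. E (g i) z)"
proof (induction I rule: infinite_finite_induct)
  case (insert i I)
  then show ?case by (simp add: transl_comb_plus[OF insert.prems])
qed (auto simp: transl_comb_const)

lemma transl_comb_translate_arg: "transl_comb w E \<Longrightarrow> E (\<lambda>z. g (z + v)) z = E g (z + v)"
  by (induction arbitrary: z rule: transl_comb.induct) (auto simp: ac_simps)

lemma transl_comb_commute: "transl_comb w' E' \<Longrightarrow> transl_comb w E \<Longrightarrow> E (E' g) z = E' (E g) z"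
proof (induction arbitrary: z rule: transl_comb.induct)
  case transl_comb_zero
  then show ?case by (simp add: transl_comb_const)
next
  case (transl_comb_step w' E' a y)
  then show ?case
    by (simp add: transl_comb_plus[OF transl_comb_step.prems] transl_comb_cmult[OF transl_comb_step.prems] transl_comb_translate_arg[OF transl_comb_step.prems])
qed

lemma transl_comb_Ck: "transl_comb w E \<Longrightarrow> Ck k g \<Longrightarrow> Ck k (E g)"
  by (induction rule: transl_comb.induct) (auto intro!: Ck_add Ck_cmult Ck_translate)

lemma transl_comb_pd:
  assumes "transl_comb w E" "Ck (Suc 0) g"
  shows "pd i (E g) = E (pd i g)"
  using assms
proof (induction rule: transl_comb.induct)
  case transl_comb_zero
  then show ?case by (simp add: pd_const)
next
  case (transl_comb_step w E a y)
  have d: "g differentiable (at x)" "E g differentiable (at x)" for x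
    using transl_comb_step.prems transl_comb_Ck[OF transl_comb_step.hyps(1) transl_comb_step.prems] by (auto intro: Ck_Suc_D)
  have d': "(\<lambda>x. g (x + y)) differentiable (at x)" for x
    using Ck_translate[OF transl_comb_step.prems] by (rule Ck_Suc_D)
  then have d'': "(\<lambda>x. a * g (x + y)) differentiable (at x)" for x
    by simp
  show ?case
    using d d' d'' transl_comb_step.IH[OF transl_comb_step.prems] by (simp add: pd_add pd_cmult pd_translate)
qed

text \<open>
  Partial sums of the Neumann series of \<open>\<alpha> (\<alpha> + \<mu> - S)\<^sup>-\<^sup>1\<close>, written as the fixed-point iteration for
  \<open>(\<alpha> + \<mu>) G = \<alpha> g + S G\<close>.
\<close>

primrec neumann :: "real \<Rightarrow> real \<Rightarrow> (('a \<Rightarrow> real) \<Rightarrow> 'a \<Rightarrow> real) \<Rightarrow> nat \<Rightarrow> ('a \<Rightarrow> real) \<Rightarrow> 'a \<Rightarrow> real" where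
  "neumann \<alpha> \<mu> S 0 = (\<lambda>g z. 0)"
| "neumann \<alpha> \<mu> S (Suc k) = (\<lambda>g z. \<alpha> / (\<alpha> + \<mu>) * g z + 1 / (\<alpha> + \<mu>) * S (neumann \<alpha> \<mu> S k g) z)"

lemma transl_comb_neumann:
  assumes "transl_comb \<mu> S" "0 < \<alpha>"
  shows "\<exists>w\<le>1. transl_comb w (neumann \<alpha> \<mu> S k)"
proof (induction k)
  case 0
  then show ?case by (auto intro: transl_comb_zero exI[of _ 0])
next
  case (Suc k)
  then obtain w where w: "w \<le> 1" "transl_comb w (neumann \<alpha> \<mu> S k)" by blast
  have \<mu>: "0 \<le> \<mu>" using assms transl_comb_mass_nonneg by blast
  have "transl_comb (\<alpha> / (\<alpha> + \<mu>) * 1 + 1 / (\<alpha> + \<mu>) * (\<mu> * w)) (neumann \<alpha> \<mu> S (Suc k))"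
    unfolding neumann.simps using assms \<mu> w
    by (intro transl_comb_add transl_comb_scale transl_comb_id transl_comb_compose) auto
  moreover have "\<alpha> / (\<alpha> + \<mu>) * 1 + 1 / (\<alpha> + \<mu>) * (\<mu> * w) \<le> 1"
  proof -
    have "\<alpha> / (\<alpha> + \<mu>) * 1 + 1 / (\<alpha> + \<mu>) * (\<mu> * w) = (\<alpha> + \<mu> * w) / (\<alpha> + \<mu>)"
      by (simp add: add_divide_distrib)
    also have "\<dots> \<le> 1" using assms \<mu> w mult_left_mono[of w 1 \<mu>] by (simp add: divide_le_eq)
    finally show ?thesis .
  qed
  ultimately show ?case by blast
qed

text \<open>
  Consecutive iterates approach each other geometrically, because the total weight \<open>\<mu>\<close> of \<open>S\<close> is less than \<open>\<alpha> + \<mu>\<close>.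
\<close>

lemma neumann_step_bound:
  assumes S: "transl_comb \<mu> S" and l: "0 < \<alpha>" and g: "\<And>z. \<bar>g z\<bar> \<le> m"
  shows "\<bar>neumann \<alpha> \<mu> S (Suc k) g z - neumann \<alpha> \<mu> S k g z\<bar> \<le> (\<mu> / (\<alpha> + \<mu>)) ^ k * m"
proof (induction k arbitrary: z)
  case 0
  have \<mu>: "0 \<le> \<mu>" using assms transl_comb_mass_nonneg by blast
  have "0 \<le> m" using g[of 0] by linarith
  have "\<bar>\<alpha> / (\<alpha> + \<mu>) * g z\<bar> = \<alpha> / (\<alpha> + \<mu>) * \<bar>g z\<bar>" using l \<mu> by (simp add: abs_mult)
  also have "\<dots> \<le> 1 * m" using g l \<mu> by (intro mult_mono) auto
  finally show ?case using transl_comb_const[OF S, of 0] by simp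
next
  case (Suc k)
  have \<mu>: "0 \<le> \<mu>" using assms transl_comb_mass_nonneg by blast
  have "neumann \<alpha> \<mu> S (Suc (Suc k)) g z - neumann \<alpha> \<mu> S (Suc k) g z
     = 1 / (\<alpha> + \<mu>) * S (\<lambda>z. neumann \<alpha> \<mu> S (Suc k) g z - neumann \<alpha> \<mu> S k g z) z"
    unfolding transl_comb_diff[OF S] by (simp add: right_diff_distrib diff_divide_distrib)
  also have "\<bar>\<dots>\<bar> = 1 / (\<alpha> + \<mu>) * \<bar>S (\<lambda>z. neumann \<alpha> \<mu> S (Suc k) g z - neumann \<alpha> \<mu> S k g z) z\<bar>"
    using l \<mu> by (simp add: abs_mult)
  also have "\<dots> \<le> 1 / (\<alpha> + \<mu>) * (\<mu> * ((\<mu> / (\<alpha> + \<mu>)) ^ k * m))"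
    using l \<mu> Suc.IH by (intro mult_left_mono transl_comb_bound[OF S]) auto
  finally show ?case by (simp add: mult_ac)
qed

lemma approximate_resolvent:
  assumes S: "transl_comb \<mu> S" and l: "0 < \<alpha>" and \<eta>: "0 < \<eta>"
  shows "\<exists>R w. transl_comb w R \<and> w \<le> 1 \<and> (\<forall>g m z. (\<forall>z. \<bar>g z\<bar> \<le> m) \<longrightarrow>
           \<bar>\<alpha> * R g z - (S (R g) z - \<mu> * R g z) - \<alpha> * g z\<bar> \<le> \<eta> * m)"
proof -
  have \<mu>: "0 \<le> \<mu>" using S transl_comb_mass_nonneg by blast
  define q where "q = \<mu> / (\<alpha> + \<mu>)"
  have q: "0 \<le> q" "q < 1" using l \<mu> by (auto simp: q_def)
  obtain k where k: "q ^ k < \<eta> / (\<alpha> + \<mu>)"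
    using real_arch_pow_inv[of "\<eta> / (\<alpha> + \<mu>)" q] q l \<mu> \<eta> by auto
  define R where "R = neumann \<alpha> \<mu> S k"
  obtain w where w: "w \<le> 1" "transl_comb w R" using transl_comb_neumann[OF S l] unfolding R_def by blast
  have "\<bar>\<alpha> * R g z - (S (R g) z - \<mu> * R g z) - \<alpha> * g z\<bar> \<le> \<eta> * m"
    if g: "\<And>z. \<bar>g z\<bar> \<le> m" for g m z
  proof -
    have m: "0 \<le> m" using g[of 0] by linarith
    have "\<alpha> * R g z - (S (R g) z - \<mu> * R g z) - \<alpha> * g z
      = (\<alpha> + \<mu>) * (R g z - neumann \<alpha> \<mu> S (Suc k) g z)"
    proof -
      have "(\<alpha> + \<mu>) * neumann \<alpha> \<mu> S (Suc k) g z = \<alpha> * g z + S (R g) z"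
        using l \<mu> by (simp add: R_def distrib_left)
      then show ?thesis by (simp add: right_diff_distrib distrib_right)
    qed
    then have "\<bar>\<alpha> * R g z - (S (R g) z - \<mu> * R g z) - \<alpha> * g z\<bar>
      = (\<alpha> + \<mu>) * \<bar>neumann \<alpha> \<mu> S (Suc k) g z - R g z\<bar>"
      using l \<mu> by (simp add: abs_mult abs_minus_commute)
    also have "\<dots> \<le> (\<alpha> + \<mu>) * (q ^ k * m)"
      unfolding R_def q_def using l \<mu> g by (intro mult_left_mono neumann_step_bound[OF S l]) auto
    also have "\<dots> \<le> (\<alpha> + \<mu>) * (\<eta> / (\<alpha> + \<mu>) * m)"
      using k m l \<mu> by (intro mult_left_mono mult_right_mono) auto
    also have "\<dots> = \<eta> * m" using l \<mu> by simp
    finally show ?thesis .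
  qed
  then show ?thesis using w by blast
qed

text \<open>
  The linear operator \<open>\<Delta> - c \<partial>\<^sub>t\<close>.
\<close>

definition heat_op :: "real \<Rightarrow> ('x::euclidean_space \<times> real \<Rightarrow> real) \<Rightarrow> 'x \<times> real \<Rightarrow> real" where
  "heat_op c f z = xlap f z - c * pd (0, 1) f z"

text \<open>
  The finite-difference version of \<open>heat_op\<close>. The time difference is taken backwards, so that, apart from the
  value at \<open>z\<close> itself, all values of \<open>f\<close> enter with nonnegative weights if \<open>c \<ge> 0\<close> and \<open>h > 0\<close>.
\<close>

definition heat_diff :: "real \<Rightarrow> real \<Rightarrow> ('x::euclidean_space \<times> real \<Rightarrow> real) \<Rightarrow> 'x \<times> real \<Rightarrow> real" where
  "heat_diff c h f z =
     (\<Sum>i\<in>Basis. (f (z + h *\<^sub>R (i, 0)) + f (z - h *\<^sub>R (i, 0)) - 2 * f z) / h\<^sup>2)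
     + c * ((f (z - h *\<^sub>R (0, 1)) - f z) / h)"

lemma heat_diff_TO:
  assumes "0 \<le> c" "0 < h"
  shows "\<exists>\<mu> S. transl_comb \<mu> S \<and> (\<forall>g z. heat_diff c h g z = S g z - \<mu> * (g :: 'x::euclidean_space \<times> real \<Rightarrow> real) z)"
proof -
  define S where "S = (\<lambda>(g :: 'x \<times> real \<Rightarrow> real) z.
     (\<Sum>i\<in>Basis. 1 / h\<^sup>2 * (g (z + h *\<^sub>R (i, 0)) + g (z + - (h *\<^sub>R (i, 0)))))
     + c / h * g (z + - (h *\<^sub>R (0, 1))))"
  have "transl_comb ((\<Sum>i\<in>(Basis :: 'x set). 1 / h\<^sup>2 * (1 + 1)) + c / h * 1) S"
    unfolding S_def using assms by (intro transl_comb_add transl_comb_scale transl_comb_sum transl_comb_shift finite_Basis) auto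
  moreover have "heat_diff c h g z = S g z - ((\<Sum>i\<in>(Basis :: 'x set). 1 / h\<^sup>2 * (1 + 1)) + c / h * 1) * g z" for g z
    unfolding heat_diff_def S_def add_uminus_conv_diff distrib_right sum_distrib_right
    by (simp add: algebra_simps sum_subtractf diff_divide_distrib add_divide_distrib sum.distrib)
  ultimately show ?thesis by blast
qed

lemma transl_comb_heat_op:
  assumes "transl_comb w E" "Ck 2 f"
  shows "heat_op c (E f) z = E (heat_op c f) z"
proof -
  have f1: "Ck (Suc 0) f" using assms(2) by (rule Ck_le) simp
  have f2: "Ck (Suc 0) (pd (i, 0) f)" if "i \<in> Basis" for i
    using assms(2) that unfolding numeral_2_eq_2 by (intro Ck_Suc_D) (auto simp: Basis_prod_def)
  have "xlap (E f) z = (\<Sum>i\<in>Basis. E (pd (i, 0) (pd (i, 0) f)) z)"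
    unfolding xlap_def by (intro sum.cong refl) (simp add: transl_comb_pd[OF assms(1) f1] transl_comb_pd[OF assms(1) f2])
  also have "\<dots> = E (xlap f) z"
    unfolding xlap_def[abs_def] by (simp add: transl_comb_sum_arg[OF assms(1)])
  finally show ?thesis
    unfolding heat_op_def[abs_def] by (simp add: transl_comb_diff[OF assms(1)] transl_comb_cmult[OF assms(1)] transl_comb_pd[OF assms(1) f1])
qed

lemma transl_comb_heat_diff:
  assumes "transl_comb w E" "0 \<le> c" "0 < h"
  shows "heat_diff c h (E f) z = E (heat_diff c h f) z"
proof -
  obtain \<mu> S where S: "transl_comb \<mu> S" and eq: "\<And>g z. heat_diff c h g z = S g z - \<mu> * (g :: 'a \<times> real \<Rightarrow> real) z"
    using heat_diff_TO[OF assms(2,3)] by blast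
  have "heat_diff c h f = (\<lambda>z. S f z - \<mu> * f z)" using eq by blast
  then show ?thesis by (simp add: eq transl_comb_diff[OF assms(1)] transl_comb_cmult[OF assms(1)] transl_comb_commute[OF S assms(1)])
qed

lemma heat_resolvent:
  assumes "0 \<le> c" "0 < h" "0 < \<alpha>" "0 < \<eta>"
  shows "\<exists>(R :: ('x::euclidean_space \<times> real \<Rightarrow> real) \<Rightarrow> 'x \<times> real \<Rightarrow> real) w. transl_comb w R \<and> w \<le> 1 \<and>
    (\<forall>g m z. (\<forall>z. \<bar>g z\<bar> \<le> m) \<longrightarrow> \<bar>\<alpha> * R g z - heat_diff c h (R g) z - \<alpha> * g z\<bar> \<le> \<eta> * m)"
proof -
  obtain \<mu> S where S: "transl_comb \<mu> S" and eq: "\<And>g z. heat_diff c h g z = S g z - \<mu> * (g :: 'x \<times> real \<Rightarrow> real) z"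
    using heat_diff_TO[OF assms(1,2)] by blast
  show ?thesis using approximate_resolvent[OF S assms(3,4)] unfolding eq .
qed

section \<open>Consistency of the difference operator\<close>

text \<open>
  Compact support, stated as vanishing outside some ball.
\<close>

definition cpt_supp :: "('a::euclidean_space \<Rightarrow> real) \<Rightarrow> bool" where
  "cpt_supp f \<longleftrightarrow> (\<exists>r. \<forall>z. r < norm z \<longrightarrow> f z = 0)"

lemma cpt_supp_pd: 
  assumes "cpt_supp f"
  shows "cpt_supp (pd i f)"
proof -
  obtain r where r: "\<And>z. r < norm z \<Longrightarrow> f z = 0" using assms unfolding cpt_supp_def by blast
  have "pd i f z = 0" if z: "r < norm z" for z
  proof -
    have "open {z::'a. r < norm z}" by (simp add: open_Collect_less continuous_on_norm)
    then have "(f has_derivative (\<lambda>d. 0)) (at z)"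
      using has_derivative_transform_within_open[OF has_derivative_const, of "{z. r < norm z}" z 0 f UNIV] z r by auto
    then show ?thesis by (rule pd_eqI)
  qed
  then show ?thesis unfolding cpt_supp_def by blast
qed

lemma cpt_supp_uniformly_continuous:
  assumes "cpt_supp f" "continuous_on UNIV f"
  shows "uniformly_continuous_on UNIV f"
proof -
  obtain r where r: "\<And>z. r < norm z \<Longrightarrow> f z = 0" using assms unfolding cpt_supp_def by blast
  have uc: "uniformly_continuous_on (cball 0 (r + 1)) f"
    using assms(2) by (intro compact_uniformly_continuous) (auto intro: continuous_on_subset)
  show ?thesis unfolding uniformly_continuous_on_def
  proof (intro allI impI)
    fix e :: real assume e: "0 < e"
    then obtain d where d: "d > 0" and
      *: "\<And>x y. \<lbrakk>x \<in> cball 0 (r + 1); y \<in> cball 0 (r + 1); dist y x < d\<rbrakk> \<Longrightarrow> dist (f y) (f x) < e"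
      using uc unfolding uniformly_continuous_on_def by meson
    have "dist (f y) (f x) < e" if "dist y x < min d 1" for x y
    proof (cases "norm x \<le> r + 1 \<and> norm y \<le> r + 1")
      case True
      then show ?thesis using * that by auto
    next
      case False
      have "\<bar>norm y - norm x\<bar> < 1" using that norm_triangle_ineq3[of y x] by (simp add: dist_norm)
      then have "r < norm x" "r < norm y" using False by auto
      then show ?thesis using r e by simp
    qed
    then show "\<exists>d>0. \<forall>x\<in>UNIV. \<forall>x'\<in>UNIV. dist x' x < d \<longrightarrow> dist (f x') (f x) < e"
      using d by (intro exI[of _ "min d 1"]) auto
  qed
qed

lemma cpt_supp_bounded:
  assumes "cpt_supp f" "continuous_on UNIV f"
  shows "\<exists>m>0. \<forall>z. \<bar>f z\<bar> \<le> m"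
proof -
  obtain r where r: "\<And>z. r < norm z \<Longrightarrow> f z = 0" using assms unfolding cpt_supp_def by blast
  have "bounded (f ` cball 0 r)"
    using assms(2) by (intro compact_imp_bounded compact_continuous_image) (auto intro: continuous_on_subset)
  then obtain m where m: "m > 0" "\<And>z. norm z \<le> r \<Longrightarrow> \<bar>f z\<bar> \<le> m"
    unfolding bounded_pos by (auto simp: image_iff)
  have "\<bar>f z\<bar> \<le> m" for z using m r[of z] by (cases "norm z \<le> r") auto
  then show ?thesis using m by blast
qed

lemma cpt_supp_close:
  assumes "cpt_supp f" "continuous_on UNIV f" "0 < \<epsilon>"
  shows "\<exists>r>0. \<forall>z v. norm v < r \<longrightarrow> \<bar>f (z + v) - f z\<bar> \<le> \<epsilon>"
proof -
  obtain d where "d > 0" and d: "\<And>x y. dist y x < d \<Longrightarrow> dist (f y) (f x) < \<epsilon>"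
    using cpt_supp_uniformly_continuous[OF assms(1,2)] assms(3) unfolding uniformly_continuous_on_def by (meson UNIV_I)
  have "\<bar>f (z + v) - f z\<bar> \<le> \<epsilon>" if "norm v < d" for z v
    using d[of "z + v" z] that by (simp add: dist_norm)
  then show ?thesis using \<open>d > 0\<close> by blast
qed

lemma second_difference:
  assumes f: "Ck 2 f" and e: "e \<in> Basis" and h: "0 < h"
    and close: "\<And>s. \<bar>s\<bar> < h \<Longrightarrow> \<bar>pd e (pd e f) (z + s *\<^sub>R e) - pd e (pd e f) z\<bar> \<le> \<epsilon>"
  shows "\<bar>(f (z + h *\<^sub>R e) + f (z - h *\<^sub>R e) - 2 * f z) / h\<^sup>2 - pd e (pd e f) z\<bar> \<le> \<epsilon>"
proof -
  have d1: "f differentiable (at x)" and d2: "pd e f differentiable (at x)" for x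
    using f e unfolding numeral_2_eq_2 by (meson Ck_Suc_D)+
  have D1: "((\<lambda>s. f (z + s *\<^sub>R e)) has_real_derivative pd e f (z + s *\<^sub>R e)) (at s)"
    and D2: "((\<lambda>s. pd e f (z + s *\<^sub>R e)) has_real_derivative pd e (pd e f) (z + s *\<^sub>R e)) (at s)" for s
    by (rule line_derivative, fact)+
  have m: "((\<lambda>s::real. - s) has_real_derivative -1) (at s)" for s by (auto intro!: derivative_eq_intros)
  have N1: "((\<lambda>s. f (z + (- s) *\<^sub>R e)) has_real_derivative - pd e f (z + (- s) *\<^sub>R e)) (at s)" for s
    using DERIV_chain2[OF D1[of "- s"] m[of s]] by simp
  have N2: "((\<lambda>s. - pd e f (z + (- s) *\<^sub>R e)) has_real_derivative pd e (pd e f) (z + (- s) *\<^sub>R e)) (at s)" for s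
    using DERIV_minus[OF DERIV_chain2[OF D2[of "- s"] m[of s]]] by simp
  define G where "G = pd e (pd e f)"
  obtain t where t: "0 < t" "t < h" and T: "f (z + h *\<^sub>R e) = f z + pd e f z * h + G (z + t *\<^sub>R e) / 2 * h\<^sup>2"
    using Taylor_second_1D[OF D1 D2 h] unfolding G_def by auto
  obtain t' where t': "0 < t'" "t' < h" and T': "f (z - h *\<^sub>R e) = f z - pd e f z * h + G (z + (- t') *\<^sub>R e) / 2 * h\<^sup>2"
    using Taylor_second_1D[OF N1 N2 h] unfolding G_def by auto
  have "(f (z + h *\<^sub>R e) + f (z - h *\<^sub>R e) - 2 * f z) / h\<^sup>2 = (G (z + t *\<^sub>R e) + G (z + (- t') *\<^sub>R e)) / 2"
    unfolding T T' using h by (simp add: field_simps)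
  moreover have "\<bar>G (z + t *\<^sub>R e) - G z\<bar> \<le> \<epsilon>" "\<bar>G (z + (- t') *\<^sub>R e) - G z\<bar> \<le> \<epsilon>"
    unfolding G_def using t t' by (intro close; simp)+
  moreover have "\<bar>x - g\<bar> \<le> \<epsilon> \<Longrightarrow> \<bar>y - g\<bar> \<le> \<epsilon> \<Longrightarrow> \<bar>(x + y) / 2 - g\<bar> \<le> \<epsilon>" for x y g :: real
    by (auto simp: abs_le_iff field_simps)
  ultimately show ?thesis unfolding G_def[symmetric] by metis
qed

lemma first_difference:
  assumes f: "\<And>x. f differentiable (at x)" and h: "0 < h"
    and close: "\<And>s. \<bar>s\<bar> < h \<Longrightarrow> \<bar>pd e f (z + s *\<^sub>R e) - pd e f z\<bar> \<le> \<epsilon>"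
  shows "\<bar>(f (z - h *\<^sub>R e) - f z) / h + pd e f z\<bar> \<le> \<epsilon>"
proof -
  have D1: "((\<lambda>s. f (z + s *\<^sub>R e)) has_real_derivative pd e f (z + s *\<^sub>R e)) (at s)" for s
    by (rule line_derivative, fact)
  obtain t where t: "-h < t" "t < 0" and "f (z + 0 *\<^sub>R e) - f (z + (-h) *\<^sub>R e) = (0 - (-h)) * pd e f (z + t *\<^sub>R e)"
    using MVT2[of "-h" 0 "\<lambda>s. f (z + s *\<^sub>R e)" "\<lambda>s. pd e f (z + s *\<^sub>R e)"] D1 h by auto
  then have "(f (z - h *\<^sub>R e) - f z) / h = - pd e f (z + t *\<^sub>R e)"
    using h by (simp add: field_simps)
  then show ?thesis using close[of t] t by simp
qed

text \<open>
  The differences converge uniformly, since the derivatives involved are continuous with compact support and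
  hence uniformly continuous.
\<close>

lemma heat_diff_consistent:
  fixes f :: "'x::euclidean_space \<times> real \<Rightarrow> real"
  assumes f: "Ck 2 f" "cpt_supp f" and c: "0 \<le> c" and \<epsilon>: "0 < \<epsilon>"
  shows "\<exists>h0>0. \<forall>h. 0 < h \<and> h < h0 \<longrightarrow> (\<forall>z. \<bar>heat_diff c h f z - heat_op c f z\<bar> \<le> \<epsilon>)"
proof -
  define \<delta> where "\<delta> = \<epsilon> / (real DIM('x) + c)"
  have \<delta>: "0 < \<delta>" using \<epsilon> c by (simp add: \<delta>_def add_pos_nonneg)
  have Bt: "(0, 1) \<in> (Basis :: ('x \<times> real) set)" by (simp add: Basis_prod_def)
  have Bx: "(i, 0) \<in> (Basis :: ('x \<times> real) set)" if "i \<in> Basis" for i using that by (simp add: Basis_prod_def)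
  have d1: "f differentiable (at x)" for x using f(1) by (rule Ck_pos_differentiable) simp
  have "\<exists>r>0. \<forall>z v. norm v < r \<longrightarrow> \<bar>pd (0,1) f (z + v) - pd (0,1) f z\<bar> \<le> \<delta>"
    using f Bt \<delta> unfolding numeral_2_eq_2 by (intro cpt_supp_close cpt_supp_pd Ck_continuous Ck_Suc_D(2))
  then obtain rt where rt: "rt > 0" "\<And>z v. norm v < rt \<Longrightarrow> \<bar>pd (0,1) f (z + v) - pd (0,1) f z\<bar> \<le> \<delta>" by blast
  have "\<forall>i\<in>(Basis :: 'x set). \<exists>r>0. \<forall>z v. norm v < r \<longrightarrow> \<bar>pd (i,0) (pd (i,0) f) (z + v) - pd (i,0) (pd (i,0) f) z\<bar> \<le> \<delta>"
    using f Bx \<delta> unfolding numeral_2_eq_2 by (intro ballI cpt_supp_close cpt_supp_pd Ck_continuous Ck_Suc_D(2))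
  then obtain r where r: "\<And>i. i \<in> Basis \<Longrightarrow> r i > 0"
    "\<And>i z v. i \<in> Basis \<Longrightarrow> norm v < r i \<Longrightarrow> \<bar>pd (i,0) (pd (i,0) f) (z + v) - pd (i,0) (pd (i,0) f) z\<bar> \<le> \<delta>"
    by metis
  define h0 where "h0 = Min (insert rt (r ` Basis))"
  have h0: "0 < h0" "h0 \<le> rt" "\<And>i. i \<in> Basis \<Longrightarrow> h0 \<le> r i"
  proof -
    show "0 < h0" using rt r unfolding h0_def by (subst Min_gr_iff) auto
    show "h0 \<le> rt" "\<And>i. i \<in> Basis \<Longrightarrow> h0 \<le> r i"
      unfolding h0_def by (rule Min_le; simp)+
  qed
  have "\<bar>heat_diff c h f z - heat_op c f z\<bar> \<le> \<epsilon>" if h: "0 < h" "h < h0" for h z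
  proof -
    define a where "a = (\<lambda>i. (f (z + h *\<^sub>R (i, 0)) + f (z - h *\<^sub>R (i, 0)) - 2 * f z) / h\<^sup>2 - pd (i, 0) (pd (i, 0) f) z)"
    define b where "b = (f (z - h *\<^sub>R (0, 1)) - f z) / h + pd (0, 1) f z"
    have a: "\<bar>a i\<bar> \<le> \<delta>" if i: "i \<in> Basis" for i
      unfolding a_def
    proof (rule second_difference[OF f(1) Bx[OF i] h(1)])
      fix s assume s: "\<bar>s\<bar> < h"
      have "norm (s *\<^sub>R (i, 0::real)) = \<bar>s\<bar>" using i by (simp add: norm_Pair)
      then show "\<bar>pd (i, 0) (pd (i, 0) f) (z + s *\<^sub>R (i, 0)) - pd (i, 0) (pd (i, 0) f) z\<bar> \<le> \<delta>"
        using h s h0(3)[OF i] by (intro r(2)[OF i]) linarith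
    qed
    have b: "\<bar>b\<bar> \<le> \<delta>"
      unfolding b_def
    proof (rule first_difference[OF d1 h(1)])
      fix s assume s: "\<bar>s\<bar> < h"
      have "norm (s *\<^sub>R (0::'x, 1::real)) = \<bar>s\<bar>" by (simp add: norm_Pair)
      then show "\<bar>pd (0, 1) f (z + s *\<^sub>R (0, 1)) - pd (0, 1) f z\<bar> \<le> \<delta>"
        using h s h0(2) by (intro rt(2)) linarith
    qed
    have "heat_diff c h f z - heat_op c f z = (\<Sum>i\<in>Basis. a i) + c * b"
      unfolding heat_diff_def heat_op_def xlap_def a_def b_def by (simp add: sum_subtractf algebra_simps)
    also have "\<bar>\<dots>\<bar> \<le> (\<Sum>i\<in>Basis. \<bar>a i\<bar>) + c * \<bar>b\<bar>"
      by (rule order_trans[OF abs_triangle_ineq add_mono[OF sum_abs]]) (simp add: abs_mult c)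
    also have "\<dots> \<le> (\<Sum>i\<in>(Basis :: 'x set). \<delta>) + c * \<delta>"
      using c a b by (intro add_mono sum_mono mult_left_mono) auto
    also have "\<dots> = (real DIM('x) + c) * \<delta>" by (simp add: distrib_right)
    also have "\<dots> = \<epsilon>"
    proof -
      have "real DIM('x) + c > 0" using c by (simp add: add_pos_nonneg)
      then show ?thesis by (simp add: \<delta>_def)
    qed
    finally show ?thesis .
  qed
  then show ?thesis using h0 by blast
qed

section \<open>Mollification\<close>

lemma cpt_supp_integrable:
  fixes F :: "'a::euclidean_space \<Rightarrow> real"
  assumes "cpt_supp F" "continuous_on UNIV F"
  shows "F integrable_on UNIV"
proof -
  obtain r where r: "\<And>z. r < norm z \<Longrightarrow> F z = 0" using assms unfolding cpt_supp_def by blast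
  obtain a where a: "cball (0::'a) r \<subseteq> cbox (-a) a"
    using bounded_subset_cbox_symmetric[OF bounded_cball] by blast
  have "F integrable_on cbox (-a) a"
    using assms(2) by (intro integrable_continuous) (auto intro: continuous_on_subset)
  moreover have "F x = 0" if "x \<notin> cbox (-a) a" for x
    using that a by (intro r) (auto simp: subset_iff not_le)
  ultimately show ?thesis by (rule integrable_on_superset) simp_all
qed

text \<open>
  The kernel carries the integration variable and \<open>g\<close> is translated. In this form \<open>conv \<kappa> g\<close> makes
  sense for every continuous \<open>g\<close> if \<open>\<kappa>\<close> is continuous with compact support, and averages of translates visibly commute with it.
\<close>

definition conv :: "('a::euclidean_space \<Rightarrow> real) \<Rightarrow> ('a \<Rightarrow> real) \<Rightarrow> 'a \<Rightarrow> real" where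
  "conv \<kappa> g z = integral UNIV (\<lambda>w. \<kappa> w * g (z - w))"

lemma cpt_supp_mult: "cpt_supp f \<Longrightarrow> cpt_supp (\<lambda>w. f w * g w)"
  unfolding cpt_supp_def by fastforce

lemma continuous_reflect: "continuous_on UNIV g \<Longrightarrow> continuous_on UNIV (\<lambda>w. g (z - w))" 
  for g :: "'a::euclidean_space \<Rightarrow> real"
  using continuous_on_compose2[of UNIV g UNIV "\<lambda>w. z - w"] by (simp add: continuous_intros)

context
  fixes \<kappa> :: "'a::euclidean_space \<Rightarrow> real"
  assumes \<kappa>: "continuous_on UNIV \<kappa>" "cpt_supp \<kappa>"
begin

lemma conv_integrable: "continuous_on UNIV g \<Longrightarrow> (\<lambda>w. \<kappa> w * g (z - w)) integrable_on UNIV"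
  using \<kappa> by (intro cpt_supp_integrable cpt_supp_mult continuous_on_mult continuous_reflect)

lemma conv_add:
  "continuous_on UNIV f \<Longrightarrow> continuous_on UNIV g \<Longrightarrow> conv \<kappa> (\<lambda>z. f z + g z) z = conv \<kappa> f z + conv \<kappa> g z"
  unfolding conv_def by (simp add: distrib_left integral_add conv_integrable)

lemma conv_cmult: "conv \<kappa> (\<lambda>z. a * g z) z = a * conv \<kappa> g z"
proof -
  have "(\<lambda>w. \<kappa> w * (a * g (z - w))) = (\<lambda>w. a * (\<kappa> w * g (z - w)))" by (auto simp: mult_ac)
  then show ?thesis unfolding conv_def by simp
qed

lemma conv_translate: "conv \<kappa> (\<lambda>z. g (z + y)) z = conv \<kappa> g (z + y)"
proof -
  have "z - w + y = z + y - w" for w by simp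
  then show ?thesis unfolding conv_def by presburger
qed

lemma transl_comb_continuous: "transl_comb w E \<Longrightarrow> continuous_on UNIV g \<Longrightarrow> continuous_on UNIV (E g)"
  using transl_comb_Ck[of w E 0 g] by simp

lemma transl_comb_conv: "transl_comb w E \<Longrightarrow> continuous_on UNIV g \<Longrightarrow> conv \<kappa> (E g) z = E (conv \<kappa> g) z"
proof (induction arbitrary: z rule: transl_comb.induct)
  case transl_comb_zero
  then show ?case by (simp add: conv_def)
next
  case (transl_comb_step w E a y)
  have "continuous_on UNIV (\<lambda>z. a * g (z + y))"
    using Ck_cmult[OF Ck_translate[of 0 g y], of a] transl_comb_step.prems by simp
  then have "conv \<kappa> (\<lambda>z. E g z + a * g (z + y)) z = conv \<kappa> (E g) z + conv \<kappa> (\<lambda>z. a * g (z + y)) z"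
    using transl_comb_step.prems transl_comb_continuous[OF transl_comb_step.hyps(1)] by (intro conv_add)
  then show ?case using transl_comb_step by (simp add: conv_cmult conv_translate)
qed

lemma conv_mono:
  assumes "\<And>w. 0 \<le> \<kappa> w" "\<And>w. r < norm w \<Longrightarrow> \<kappa> w = 0"
    and "continuous_on UNIV f" "continuous_on UNIV g"
    and "\<And>w. norm w \<le> r \<Longrightarrow> f (z - w) \<le> g (z - w)"
  shows "conv \<kappa> f z \<le> conv \<kappa> g z"
  unfolding conv_def
proof (rule integral_le)
  show "\<kappa> w * f (z - w) \<le> \<kappa> w * g (z - w)" for w
    using assms(1)[of w] assms(2)[of w] assms(5)[of w] by (cases "norm w \<le> r") (auto intro: mult_left_mono)
qed (use assms in \<open>auto intro: conv_integrable\<close>)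

lemma conv_const: "conv \<kappa> (\<lambda>z. a) z = a * integral UNIV \<kappa>"
  unfolding conv_def by simp

text \<open>
  The form with translated kernel, used for differentiation.
\<close>

lemma conv_swap:
  assumes g: "continuous_on UNIV g"
  shows "conv \<kappa> g z = integral UNIV (\<lambda>w. \<kappa> (z - w) * g w)"
proof -
  define F where "F = (\<lambda>w. \<kappa> w * g (z - w))"
  have F: "continuous_on UNIV F" unfolding F_def
    using \<kappa> g by (intro continuous_on_mult continuous_reflect)
  obtain r where r: "\<And>w. r < norm w \<Longrightarrow> F w = 0"
    using \<kappa>(2) unfolding cpt_supp_def F_def by fastforce
  obtain a where a: "cball (0::'a) r \<subseteq> cbox (-a) a"
    using bounded_subset_cbox_symmetric[OF bounded_cball] by blast
  have out: "F w = 0" if "w \<notin> cbox (-a) a" for w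
    using that a by (intro r) (auto simp: subset_iff not_le)
  have 1: "(F has_integral integral (cbox (-a) a) F) (cbox (-a) a)"
    using F by (intro integrable_integral integrable_continuous) (auto intro: continuous_on_subset)
  then have "(F has_integral integral (cbox (-a) a) F) UNIV"
    by (rule has_integral_on_superset) (auto intro: out)
  then have L: "conv \<kappa> g z = integral (cbox (-a) a) F"
    unfolding conv_def F_def by (rule integral_unique)
  have "((\<lambda>w. F (- w + z)) has_integral integral (cbox (-a) a) F) ((\<lambda>w. - w + z) ` cbox (-a) a)"
    using has_integral_affinity[OF 1, of "-1" z] by simp
  then have "((\<lambda>w. F (- w + z)) has_integral integral (cbox (-a) a) F) UNIV"
  proof (rule has_integral_on_superset)
    fix w assume w: "w \<notin> (\<lambda>w. - w + z) ` cbox (-a) a"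
    show "F (- w + z) = 0"
    proof (rule out)
      show "- w + z \<notin> cbox (-a) a"
      proof
        assume "- w + z \<in> cbox (-a) a"
        then have "- (- w + z) + z \<in> (\<lambda>w. - w + z) ` cbox (-a) a" by (rule imageI)
        then show False using w by simp
      qed
    qed
  qed simp
  then have "integral UNIV (\<lambda>w. F (- w + z)) = integral (cbox (-a) a) F" by (rule integral_unique)
  then show ?thesis using L unfolding F_def by (simp add: algebra_simps)
qed

lemma conv_cpt_supp:
  assumes g: "cpt_supp g"
  shows "cpt_supp (conv \<kappa> g)"
proof -
  obtain r where r: "\<And>w. r < norm w \<Longrightarrow> \<kappa> w = 0" using \<kappa> unfolding cpt_supp_def by blast
  obtain s where s: "\<And>w. s < norm w \<Longrightarrow> g w = 0" using g unfolding cpt_supp_def by blast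
  have "conv \<kappa> g z = 0" if z: "r + s < norm z" for z
  proof -
    have "\<kappa> w * g (z - w) = 0" for w
    proof (cases "r < norm w")
      case False
      then have "s < norm (z - w)" using z norm_triangle_ineq2[of z w] by linarith
      then show ?thesis using s by simp
    qed (use r in simp)
    then have "(\<lambda>w. \<kappa> w * g (z - w)) = (\<lambda>w. 0)" by blast
    then show ?thesis unfolding conv_def by simp
  qed
  then show ?thesis unfolding cpt_supp_def by blast
qed

lemma conv_approx:
  assumes "\<And>w. 0 \<le> \<kappa> w" "\<And>w. r < norm w \<Longrightarrow> \<kappa> w = 0" "integral UNIV \<kappa> = 1"
    and g: "continuous_on UNIV g"
    and close: "\<And>w. norm w \<le> r \<Longrightarrow> \<bar>g (z - w) - g z\<bar> \<le> \<epsilon>"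
  shows "\<bar>conv \<kappa> g z - g z\<bar> \<le> \<epsilon>"
proof -
  have b: "g (z - w) \<le> g z + \<epsilon>" "g z - \<epsilon> \<le> g (z - w)" if "norm w \<le> r" for w
    using close[OF that] by (auto simp: abs_le_iff)
  have "conv \<kappa> g z \<le> conv \<kappa> (\<lambda>_. g z + \<epsilon>) z" "conv \<kappa> (\<lambda>_. g z - \<epsilon>) z \<le> conv \<kappa> g z"
    by (rule conv_mono[where r = r]; use assms b in simp)+
  then show ?thesis by (simp add: conv_const assms)
qed

lemma conv_bound:
  assumes "\<And>w. 0 \<le> \<kappa> w" "integral UNIV \<kappa> = 1" "continuous_on UNIV g" "\<And>w. \<bar>g w\<bar> \<le> m"
  shows "\<bar>conv \<kappa> g z\<bar> \<le> m"
proof -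
  obtain r where r: "\<And>w. r < norm w \<Longrightarrow> \<kappa> w = 0" using \<kappa> unfolding cpt_supp_def by blast
  have b: "- m \<le> g w" "g w \<le> m" for w using assms(4)[of w] by (auto simp: abs_le_iff)
  have "conv \<kappa> g z \<le> conv \<kappa> (\<lambda>_. m) z" "conv \<kappa> (\<lambda>_. - m) z \<le> conv \<kappa> g z"
    by (rule conv_mono[where r = r]; use assms r b in simp)+
  then show ?thesis by (simp add: conv_const assms)
qed

end

lemma Ck_param_integral:
  fixes \<kappa> :: "'a::euclidean_space \<Rightarrow> real"
  assumes "Ck k \<kappa>" "continuous_on UNIV g"
  shows "Ck k (\<lambda>z. integral (cbox a b) (\<lambda>w. \<kappa> (z - w) * g w))"
  using assms(1)
proof (induction k arbitrary: \<kappa>)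
  case 0
  have "continuous_on (UNIV \<times> cbox a b) (\<lambda>(z, w). \<kappa> (z - w) * g w)"
  proof -
    have "continuous_on (UNIV \<times> cbox a b) (\<lambda>x. \<kappa> (fst x - snd x))"
      by (rule continuous_on_compose2[of UNIV \<kappa>]) (use 0 in \<open>auto intro!: continuous_intros\<close>)
    moreover have "continuous_on (UNIV \<times> cbox a b) (\<lambda>x. g (snd x))"
      by (rule continuous_on_compose2[of UNIV g]) (use assms(2) in \<open>auto intro!: continuous_intros\<close>)
    ultimately show ?thesis unfolding split_def by (rule continuous_on_mult)
  qed
  from integral_continuous_on_param[OF this] show ?case by simp
next
  case (Suc k)
  define F where "F = (\<lambda>z w. \<Sum>i\<in>Basis. (pd i \<kappa> (z - w) * g w) *\<^sub>R (blinfun_inner_left i :: 'a \<Rightarrow>\<^sub>L real))"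
  have d: "\<kappa> differentiable (at x)" for x using Suc.prems by (rule Ck_Suc_D)
  have contp: "continuous_on UNIV (pd i \<kappa>)" if "i \<in> Basis" for i
    using Suc.prems that by (intro Ck_continuous Ck_Suc_D)
  have F_apply: "blinfun_apply (F z w) d = pd d \<kappa> (z - w) * g w" for z w d
    unfolding F_def by (simp add: blinfun.sum_left blinfun.scaleR_left pd_expand[OF d, of d] sum_distrib_left mult_ac)
  have der: "((\<lambda>z. integral (cbox a b) (\<lambda>w. \<kappa> (z - w) * g w)) has_derivative
       blinfun_apply (integral (cbox a b) (F z))) (at z within UNIV)" for z
  proof (rule leibniz_rule)
    fix z w :: 'a
    have "((\<lambda>z. z - w) has_derivative (\<lambda>d. d)) (at z)" by (auto intro!: derivative_eq_intros)
    from has_derivative_compose[OF this has_derivative_pd[OF d]]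
    have "((\<lambda>z. \<kappa> (z - w)) has_derivative (\<lambda>d. pd d \<kappa> (z - w))) (at z)" .
    from has_derivative_mult_left[OF this]
    show "((\<lambda>z. \<kappa> (z - w) * g w) has_derivative blinfun_apply (F z w)) (at z within UNIV)"
      unfolding F_apply[abs_def] by simp
  next
    fix z
    have "continuous_on UNIV \<kappa>" using Suc.prems by (rule Ck_continuous)
    then have "continuous_on UNIV (\<lambda>w. \<kappa> (z - w) * g w)"
      using assms(2) by (intro continuous_on_mult continuous_reflect)
    then show "(\<lambda>w. \<kappa> (z - w) * g w) integrable_on cbox a b"
      by (intro integrable_continuous) (auto intro: continuous_on_subset)
  next
    have "continuous_on (UNIV \<times> cbox a b) (\<lambda>x. pd i \<kappa> (fst x - snd x))" if "i \<in> Basis" for i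
      by (rule continuous_on_compose2[of UNIV "pd i \<kappa>"]) (use contp that in \<open>auto intro!: continuous_intros\<close>)
    moreover have "continuous_on (UNIV \<times> cbox a b) (\<lambda>x. g (snd x))"
      by (rule continuous_on_compose2[of UNIV g]) (use assms(2) in \<open>auto intro!: continuous_intros\<close>)
    ultimately show "continuous_on (UNIV \<times> cbox a b) (\<lambda>(z, w). F z w)"
      unfolding F_def split_def by (intro continuous_on_sum continuous_on_scaleR continuous_on_mult continuous_on_const)
  qed simp_all
  have Fint: "F z integrable_on cbox a b" for z
  proof (rule integrable_continuous)
    have "continuous_on (cbox a b) (\<lambda>w. pd i \<kappa> (z - w) * g w)" if "i \<in> Basis" for i
      using continuous_on_mult[OF continuous_reflect[OF contp[OF that]] assms(2)] by (rule continuous_on_subset) simp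
    then show "continuous_on (cbox a b) (F z)"
      unfolding F_def by (intro continuous_on_sum continuous_on_scaleR continuous_on_const)
  qed
  have "pd i (\<lambda>z. integral (cbox a b) (\<lambda>w. \<kappa> (z - w) * g w))
      = (\<lambda>z. integral (cbox a b) (\<lambda>w. pd i \<kappa> (z - w) * g w))" for i
  proof
    fix z
    have "pd i (\<lambda>z. integral (cbox a b) (\<lambda>w. \<kappa> (z - w) * g w)) z = blinfun_apply (integral (cbox a b) (F z)) i"
      using der[of z] by (rule pd_eqI)
    then show "pd i (\<lambda>z. integral (cbox a b) (\<lambda>w. \<kappa> (z - w) * g w)) z
      = integral (cbox a b) (\<lambda>w. pd i \<kappa> (z - w) * g w)"
      by (simp add: blinfun_apply_integral[OF Fint] F_apply)
  qed
  moreover have "Ck k (\<lambda>z. integral (cbox a b) (\<lambda>w. pd i \<kappa> (z - w) * g w))" if "i \<in> Basis" for i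
    using Suc.prems that by (intro Suc.IH Ck_Suc_D)
  ultimately show ?case using der unfolding Ck_Suc_iff differentiable_def by auto
qed

lemma conv_Ck:
  assumes \<kappa>: "Ck k \<kappa>" "cpt_supp \<kappa>" and g: "continuous_on UNIV g" "cpt_supp g"
  shows "Ck k (conv \<kappa> g)"
proof -
  have \<kappa>c: "continuous_on UNIV \<kappa>" using \<kappa>(1) by (rule Ck_continuous)
  obtain r where r: "\<And>w. r < norm w \<Longrightarrow> g w = 0" using g unfolding cpt_supp_def by blast
  obtain a where a: "cball (0::'a) r \<subseteq> cbox (-a) a"
    using bounded_subset_cbox_symmetric[OF bounded_cball] by blast
  have out: "g w = 0" if "w \<notin> cbox (-a) a" for w
    using that a by (intro r) (auto simp: subset_iff not_le)
  have "conv \<kappa> g z = integral (cbox (-a) a) (\<lambda>w. \<kappa> (z - w) * g w)" for z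
  proof -
    have "continuous_on UNIV (\<lambda>w. \<kappa> (z - w) * g w)"
      using \<kappa>c g by (intro continuous_on_mult continuous_reflect)
    then have "(\<lambda>w. \<kappa> (z - w) * g w) integrable_on cbox (-a) a"
      by (intro integrable_continuous) (auto intro: continuous_on_subset)
    then have "((\<lambda>w. \<kappa> (z - w) * g w) has_integral integral (cbox (-a) a) (\<lambda>w. \<kappa> (z - w) * g w)) UNIV"
      by (rule has_integral_on_superset[OF integrable_integral]) (auto simp: out)
    then show ?thesis unfolding conv_swap[OF \<kappa>c \<kappa>(2) g(1)] by (rule integral_unique)
  qed
  then show ?thesis using Ck_param_integral[OF \<kappa>(1) g(1), of "-a" a] by presburger
qed

lemma DERIV_pos_part_power:
  assumes "2 \<le> m"
  shows "((\<lambda>x::real. (max 0 x) ^ m) has_real_derivative real m * (max 0 x) ^ (m - 1)) (at x)"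
proof -
  consider "x < 0" | "x = 0" | "x > 0" by linarith
  then show ?thesis
  proof cases
    case 1
    have "((\<lambda>x::real. 0) has_real_derivative 0) (at x)" by simp
    then have "((\<lambda>x::real. (max 0 x) ^ m) has_real_derivative 0) (at x)"
      by (rule has_field_derivative_transform_within_open[where S = "{..<0}"]) (use 1 assms in auto)
    moreover have "real m * (max 0 x) ^ (m - 1) = 0" using 1 assms by (simp add: max_def zero_power)
    ultimately show ?thesis by metis
  next
    case 2
    \<comment> \<open>Caratheodory form of the derivative at the kink: the difference quotient is continuous\<close>
    have "(max 0 z) ^ m = (max 0 z) ^ (m - 1) * z" for z :: real
      using assms by (cases m) (auto simp: max_def)
    moreover have "isCont (\<lambda>z::real. (max 0 z) ^ (m - 1)) 0" by (intro continuous_intros)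
    ultimately show ?thesis unfolding CARAT_DERIV 2 using assms
      by (intro exI[of _ "\<lambda>z. (max 0 z) ^ (m - 1)"]) auto
  next
    case 3
    have "((\<lambda>x. x ^ m) has_real_derivative real m * x ^ (m - 1)) (at x)"
      by (auto intro!: derivative_eq_intros)
    then have "((\<lambda>x::real. (max 0 x) ^ m) has_real_derivative real m * x ^ (m - 1)) (at x)"
      by (rule has_field_derivative_transform_within_open[where S = "{0<..}"]) (use 3 in auto)
    then show ?thesis using 3 by (simp add: max_def)
  qed
qed

text \<open>
  The functions \<open>P(w) max(0, s - |w|\<^sup>2)\<^sup>m\<close> with smooth \<open>P\<close> are closed under partial differentiation, at the cost of lowering \<open>m\<close> by
  one. A kernel of finite smoothness suffices here, so no infinitely differentiable bump function is needed.
\<close>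

lemma Ck_bump:
  assumes "\<And>k. Ck k (P :: 'a::euclidean_space \<Rightarrow> real)" "k < m"
  shows "Ck k (\<lambda>w. P w * (max 0 (s - w \<bullet> w)) ^ m)"
  using assms
proof (induction k arbitrary: P m)
  case 0
  have "continuous_on UNIV P" using 0(1)[of 0] by simp
  then show ?case by (auto intro!: continuous_intros)
next
  case (Suc k)
  define Q where "Q = (\<lambda>w::'a. (max 0 (s - w \<bullet> w)) ^ m)"
  have dP: "P differentiable (at x)" for x using Suc.prems(1)[of "Suc 0"] by (rule Ck_Suc_D)
  have Q: "(Q has_derivative (\<lambda>d. real m * (max 0 (s - x \<bullet> x)) ^ (m - 1) * (- 2 * (x \<bullet> d)))) (at x)" for x
  proof -
    have "((\<lambda>w. s - w \<bullet> w) has_derivative (\<lambda>d. - 2 * (x \<bullet> d))) (at x)"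
      by (auto intro!: derivative_eq_intros simp: inner_commute)
    from has_derivative_compose[OF this DERIV_pos_part_power[unfolded has_field_derivative_def]]
    show ?thesis unfolding Q_def using Suc.prems(2) by auto
  qed
  then have dQ: "Q differentiable (at x)" for x unfolding differentiable_def by blast
  have pdQ: "pd i Q x = real m * (max 0 (s - x \<bullet> x)) ^ (m - 1) * (- 2 * (x \<bullet> i))" for i x
    using Q by (rule pd_eqI)
  have "Ck k (pd i (\<lambda>w. P w * Q w))" if i: "i \<in> Basis" for i
  proof -
    have "Ck j (pd i P)" for j using Suc.prems(1)[of "Suc j"] i by (rule Ck_Suc_D)
    then have 1: "Ck k (\<lambda>w. pd i P w * Q w)" unfolding Q_def using Suc.prems(2) by (intro Suc.IH) auto
    have "Ck j (\<lambda>w. P w * (real m * (- 2 * (w \<bullet> i))))" for j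
      using Suc.prems(1) by (intro Ck_mult Ck_const Ck_inner)
    then have 2: "Ck k (\<lambda>w. P w * (real m * (- 2 * (w \<bullet> i))) * (max 0 (s - w \<bullet> w)) ^ (m - 1))"
      using Suc.prems(2) by (intro Suc.IH) auto
    have "pd i (\<lambda>w. P w * Q w) = (\<lambda>w. P w * (real m * (- 2 * (w \<bullet> i))) * (max 0 (s - w \<bullet> w)) ^ (m - 1) + pd i P w * Q w)"
      by (simp add: pd_mult[OF dP dQ] pdQ mult_ac)
    then show ?thesis using Ck_add[OF 2 1] by simp
  qed
  then show ?case unfolding Ck_Suc_iff using dP dQ by (auto simp: Q_def)
qed

lemma mollifier_exists:
  assumes "0 < r"
  obtains \<kappa> :: "'a::euclidean_space \<Rightarrow> real"
  where "Ck k \<kappa>" "\<And>w. 0 \<le> \<kappa> w" "\<And>w. r < norm w \<Longrightarrow> \<kappa> w = 0" "integral UNIV \<kappa> = 1"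
proof -
  define b :: "'a \<Rightarrow> real" where "b = (\<lambda>w. 1 * (max 0 (r\<^sup>2 - w \<bullet> w)) ^ Suc k)"
  have b: "Ck k b" unfolding b_def by (rule Ck_bump) simp_all
  then have bc: "continuous_on UNIV b" by (rule Ck_continuous)
  have b0: "0 \<le> b w" for w unfolding b_def by simp
  have bout: "b w = 0" if "r < norm w" for w
  proof -
    have "r\<^sup>2 \<le> (norm w)\<^sup>2" using that assms by (intro power_mono) auto
    then show ?thesis by (simp add: b_def dot_square_norm)
  qed
  then have bs: "cpt_supp b" unfolding cpt_supp_def by blast
  obtain a where a: "cball (0::'a) r \<subseteq> cbox (-a) a"
    using bounded_subset_cbox_symmetric[OF bounded_cball] by blast
  have 0: "(b has_integral integral UNIV b) UNIV"
    using cpt_supp_integrable[OF bs bc] by (rule integrable_integral)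
  define I where "I = integral UNIV b"
  have "0 \<le> I" unfolding I_def using cpt_supp_integrable[OF bs bc] b0 by (intro integral_nonneg) auto
  moreover have "I \<noteq> 0"
  proof
    assume "I = 0"
    have out: "b w = 0" if "w \<notin> cbox (-a) a" for w
      using that a by (intro bout) (auto simp: subset_iff not_le)
    have c: "continuous_on (cbox (-a) a) b" using bc by (rule continuous_on_subset) simp
    have "(b has_integral integral (cbox (-a) a) b) UNIV"
      by (rule has_integral_on_superset[OF integrable_integral[OF integrable_continuous[OF c]]]) (auto simp: out)
    then have "integral (cbox (-a) a) b = 0"
      using \<open>I = 0\<close> 0 has_integral_unique unfolding I_def by metis
    moreover have "box (-a) a \<noteq> {}"
      unfolding box_ne_empty
    proof
      fix i :: 'a assume i: "i \<in> Basis"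
      have "r *\<^sub>R i \<in> cball 0 r" using assms i by simp
      then have "r *\<^sub>R i \<in> cbox (-a) a" using a by blast
      then have "r \<le> a \<bullet> i" using i by (force simp: mem_box)
      then show "- a \<bullet> i < a \<bullet> i" using assms by simp
    qed
    ultimately have "b w = 0" if "w \<in> cbox (-a) a" for w
      using integral_cbox_eq_0_iff[OF c] b0 that by auto
    moreover have "0 \<in> cbox (-a) a" using a assms by (auto simp: subset_iff)
    ultimately have "b 0 = 0" by blast
    then show False using assms by (simp add: b_def)
  qed
  ultimately have I: "0 < I" by simp
  show ?thesis
  proof
    show "Ck k (\<lambda>w. 1 / I * b w)" using b by (rule Ck_cmult)
    show "0 \<le> 1 / I * b w" for w using I b0 by simp
    show "1 / I * b w = 0" if "r < norm w" for w using bout that by simp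
    show "integral UNIV (\<lambda>w. 1 / I * b w) = 1" using I by (simp add: I_def)
  qed
qed

section \<open>Mollified subsolutions of the heat equation\<close>

lemma Basis_prod_x: "i \<in> Basis \<Longrightarrow> (i, 0) \<in> (Basis :: ('x::euclidean_space \<times> real) set)"
  and Basis_prod_t: "(0, 1) \<in> (Basis :: ('x::euclidean_space \<times> real) set)"
  by (simp_all add: Basis_prod_def)

lemma heat_op_add:
  assumes "Ck 2 f" "Ck 2 g"
  shows "heat_op c (\<lambda>z. f z + g z) z = heat_op c f z + heat_op c g z"
proof -
  have d: "f differentiable (at x)" "g differentiable (at x)" for x
    using assms by (auto intro: Ck_pos_differentiable)
  have d2: "pd (i, 0) f differentiable (at x)" "pd (i, 0) g differentiable (at x)" if "i \<in> Basis" for i x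
    using assms Basis_prod_x[OF that] unfolding numeral_2_eq_2 by (meson Ck_Suc_D)+
  show ?thesis unfolding heat_op_def xlap_def
    by (simp add: pd_add d d2 sum.distrib algebra_simps)
qed

lemma heat_op_cmult:
  assumes "Ck 2 f"
  shows "heat_op c (\<lambda>z. a * f z) z = a * heat_op c f z"
proof -
  have d: "f differentiable (at x)" for x
    using assms by (auto intro: Ck_pos_differentiable)
  have d2: "pd (i, 0) f differentiable (at x)" if "i \<in> Basis" for i x
    using assms Basis_prod_x[OF that] unfolding numeral_2_eq_2 by (meson Ck_Suc_D)
  show ?thesis unfolding heat_op_def xlap_def
    by (simp add: pd_cmult d d2 sum_distrib_left algebra_simps)
qed

lemma Ck_heat_op:
  assumes "Ck (Suc (Suc k)) f"
  shows "Ck k (heat_op c f)"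
proof -
  have "Ck k (pd (i, 0) (pd (i, 0) f))" if "i \<in> Basis" for i
    using assms Basis_prod_x[OF that] by (meson Ck_Suc_D)
  moreover have "Ck k (pd (0, 1) f)"
    using assms Basis_prod_t by (meson Ck_Suc_D Ck_Suc_imp_Ck)
  ultimately have "Ck k (\<lambda>z. (\<Sum>i\<in>Basis. pd (i, 0) (pd (i, 0) f) z) - c * pd (0, 1) f z)"
    by (intro Ck_diff Ck_sum Ck_cmult)
  then show ?thesis unfolding heat_op_def[abs_def] xlap_def[abs_def] .
qed

lemma cpt_supp_diff: 
  assumes "cpt_supp f" "cpt_supp g" shows "cpt_supp (\<lambda>z. f z - g z)"
proof -
  obtain r s where "\<And>z. r < norm z \<Longrightarrow> f z = 0" "\<And>z. s < norm z \<Longrightarrow> g z = 0"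
    using assms unfolding cpt_supp_def by blast
  then show ?thesis unfolding cpt_supp_def by (intro exI[of _ "max r s"]) auto
qed

lemma cpt_supp_sum: "finite I \<Longrightarrow> (\<And>i. i \<in> I \<Longrightarrow> cpt_supp (f i)) \<Longrightarrow> cpt_supp (\<lambda>z. \<Sum>i\<in>I. f i z)"
proof (induction I rule: finite_induct)
  case empty
  then show ?case by (simp add: cpt_supp_def)
next
  case (insert i I)
  then obtain r s where "\<And>z. r < norm z \<Longrightarrow> f i z = 0" "\<And>z. s < norm z \<Longrightarrow> (\<Sum>i\<in>I. f i z) = 0"
    unfolding cpt_supp_def by (metis insert_iff)
  then show ?case using insert.hyps unfolding cpt_supp_def by (intro exI[of _ "max r s"]) auto
qed

lemma cpt_supp_heat_op:
  assumes "cpt_supp f" shows "cpt_supp (heat_op c f)"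
proof -
  have "cpt_supp (\<lambda>z. (\<Sum>i\<in>Basis. pd (i, 0) (pd (i, 0) f) z) - pd (0, 1) f z * c)"
    using assms by (intro cpt_supp_diff cpt_supp_sum cpt_supp_mult cpt_supp_pd finite_Basis)
  then show ?thesis unfolding heat_op_def[abs_def] xlap_def[abs_def] by (simp add: mult.commute)
qed

text \<open>
  Near \<open>y\<close> the image of the quartic \<open>|z - y|\<^sup>4\<close> is bounded above by a multiple of \<open>|z - y|\<^sup>2\<close>, which will be
  absorbed by the zero-order term of the resolvent equation.
\<close>

lemma heat_op_quartic:
  fixes z y :: "'x::euclidean_space \<times> real"
  assumes c: "0 \<le> c" and z: "norm (z - y) \<le> 1"
  shows "heat_op c (\<lambda>z. ((z - y) \<bullet> (z - y))\<^sup>2) z \<le> (8 + 4 * real DIM('x) + 4 * c) * ((z - y) \<bullet> (z - y))"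
proof -
  have pd1: "pd i (\<lambda>z. ((z - y) \<bullet> (z - y))\<^sup>2) = (\<lambda>z. 4 * ((z - y) \<bullet> (z - y)) * ((z - y) \<bullet> i))" for i
    by (rule ext, rule pd_eqI[THEN trans], (rule derivative_eq_intros refl)+)
       (simp add: inner_commute power2_eq_square algebra_simps)
  have pd2: "pd i (\<lambda>z. 4 * ((z - y) \<bullet> (z - y)) * ((z - y) \<bullet> i)) z = 8 * ((z - y) \<bullet> i)\<^sup>2 + 4 * ((z - y) \<bullet> (z - y)) * (i \<bullet> i)" for i
    by (rule pd_eqI[THEN trans], (rule derivative_eq_intros refl)+)
       (simp add: inner_commute power2_eq_square algebra_simps)
  define s where "s = (z - y) \<bullet> (z - y)"
  have s: "0 \<le> s" unfolding s_def by simp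
  have "xlap (\<lambda>z. ((z - y) \<bullet> (z - y))\<^sup>2) z = (\<Sum>i\<in>Basis. 8 * ((fst z - fst y) \<bullet> i)\<^sup>2 + 4 * s)"
    unfolding xlap_def pd1 pd2 s_def by (intro sum.cong) (auto simp: inner_prod_def)
  also have "\<dots> = 8 * (\<Sum>i\<in>Basis. ((fst z - fst y) \<bullet> i)\<^sup>2) + 4 * real DIM('x) * s"
    by (simp add: sum.distrib sum_distrib_left)
  also have "(\<Sum>i\<in>Basis. ((fst z - fst y) \<bullet> i)\<^sup>2) = (fst z - fst y) \<bullet> (fst z - fst y)"
    by (simp add: euclidean_inner[of "fst z - fst y" "fst z - fst y"] power2_eq_square)
  also have "\<dots> \<le> s" unfolding s_def by (simp add: inner_prod_def)
  finally have 1: "xlap (\<lambda>z. ((z - y) \<bullet> (z - y))\<^sup>2) z \<le> 8 * s + 4 * real DIM('x) * s" by simp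
  have "\<bar>(z - y) \<bullet> (0, 1)\<bar> \<le> 1"
    using Basis_le_norm[OF Basis_prod_t, of "z - y"] z by linarith
  then have "- ((z - y) \<bullet> (0, 1)) \<le> 1" by linarith
  then have "4 * s * (- ((z - y) \<bullet> (0, 1))) \<le> 4 * s * 1" using s by (intro mult_left_mono) auto
  then have "c * (4 * s * (- ((z - y) \<bullet> (0, 1)))) \<le> c * (4 * s * 1)" using c by (rule mult_left_mono)
  then have 2: "- (c * pd (0, 1) (\<lambda>z. ((z - y) \<bullet> (z - y))\<^sup>2) z) \<le> 4 * c * s"
    unfolding pd1 s_def by (simp add: mult_ac)
  show ?thesis using 1 2 unfolding heat_op_def s_def[symmetric] by (simp add: algebra_simps)
qed

text \<open>
  Viscosity subsolutions of \<open>c u\<^sub>t = \<Delta>u\<close> in \<open>G\<close>, tested with \<open>C\<^sup>2\<close> functions. The local maximum is taken over a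
  neighbourhood in the whole space, which makes a difference only if \<open>G\<close> is not open.
\<close>

definition heat_subsolution :: "real \<Rightarrow> ('x::euclidean_space \<times> real) set \<Rightarrow> ('x \<times> real \<Rightarrow> real) \<Rightarrow> bool" where
  "heat_subsolution c G u \<longleftrightarrow> (\<forall>\<phi> z. Ck 2 \<phi> \<and> z \<in> G \<and>
      (\<forall>\<^sub>F w in nhds z. u w - \<phi> w \<le> u z - \<phi> z) \<longrightarrow> 0 \<le> heat_op c \<phi> z)"

text \<open>
  The barrier \<open>A (|z - y|\<^sup>4 + K / \<alpha>\<^sup>2)\<close> is a supersolution of the homogeneous resolvent equation near \<open>y\<close>, and its value at \<open>y\<close> is
  \<open>O(\<alpha>\<^sup>-\<^sup>2)\<close>.
\<close>

lemma quartic_barrier: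
  fixes y :: "'x::euclidean_space \<times> real"
  assumes c: "0 \<le> c" and A: "0 \<le> A" and \<alpha>: "0 < \<alpha>" and z: "norm (z - y) \<le> 1"
  defines "K \<equiv> (8 + 4 * real DIM('x) + 4 * c)\<^sup>2 / 4"
  shows "heat_op c (\<lambda>z. A * ((z - y) \<bullet> (z - y))\<^sup>2) z \<le> \<alpha> * (A * ((z - y) \<bullet> (z - y))\<^sup>2 + A * K / \<alpha>\<^sup>2)"
proof -
  define C where "C = 8 + 4 * real DIM('x) + 4 * c"
  define s where "s = (z - y) \<bullet> (z - y)"
  \<comment> \<open>the choice of \<open>K\<close> completes the square in \<open>s = |z - y|\<^sup>2\<close>\<close>
  have "0 \<le> (2 * \<alpha> * s - C)\<^sup>2 / (4 * \<alpha>)" using \<alpha> by simp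
  also have "\<dots> = \<alpha> * s\<^sup>2 + K / \<alpha> - C * s"
    using \<alpha> unfolding K_def C_def[symmetric] by (simp add: field_simps power2_eq_square)
  finally have "A * (C * s) \<le> A * (\<alpha> * s\<^sup>2 + K / \<alpha>)" using A by (intro mult_left_mono) auto
  also have "\<dots> = \<alpha> * (A * s\<^sup>2 + A * K / \<alpha>\<^sup>2)" using \<alpha> by (simp add: field_simps power2_eq_square)
  finally have 1: "A * (C * s) \<le> \<alpha> * (A * s\<^sup>2 + A * K / \<alpha>\<^sup>2)" .
  have "Ck 2 (\<lambda>z. ((z - y) \<bullet> (z - y))\<^sup>2)" by (intro Ck_power Ck_norm_sq)
  then have "heat_op c (\<lambda>z. A * ((z - y) \<bullet> (z - y))\<^sup>2) z = A * heat_op c (\<lambda>z. ((z - y) \<bullet> (z - y))\<^sup>2) z"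
    by (rule heat_op_cmult)
  also have "\<dots> \<le> A * (C * s)" unfolding C_def s_def using A heat_op_quartic[OF c z] by (intro mult_left_mono)
  finally show ?thesis using 1 unfolding s_def by linarith
qed

text \<open>
  A local comparison of a viscosity subsolution \<open>u\<close> with an approximate supersolution \<open>W\<close> of \<open>\<alpha> W - L W = \<alpha> f\<close>, where
  \<open>L = heat_op c\<close> and \<open>u \<le> f + \<eta>\<close>. The positive zero-order coefficient \<open>\<alpha>\<close> replaces initial data, so the comparison takes
  place on a ball in space-time.
\<close>

lemma resolvent_comparison:
  fixes y :: "'x::euclidean_space \<times> real"
  assumes u: "heat_subsolution c G u" "continuous_on UNIV u" and uM: "\<And>z. \<bar>u z\<bar> \<le> M"
    and G: "cball y r \<subseteq> G" and r: "0 < r" "r \<le> 1" and c: "0 \<le> c" and \<alpha>: "0 < \<alpha>"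
    and W: "Ck 2 W" "\<And>z. \<bar>W z\<bar> \<le> M" "\<And>z. heat_op c W z \<le> \<alpha> * (W z - f z) + e"
    and f: "\<And>z. u z \<le> f z + \<eta>" and e: "0 \<le> e" "0 \<le> \<eta>"
  shows "u y \<le> W y + (2 * M / r ^ 4) * ((8 + 4 * real DIM('x) + 4 * c)\<^sup>2 / 4) / \<alpha>\<^sup>2 + \<eta> + e / \<alpha>"
proof -
  define A where "A = 2 * M / r ^ 4"
  define K where "K = (8 + 4 * real DIM('x) + 4 * c)\<^sup>2 / 4"
  define B where "B = (\<lambda>z. A * ((z - y) \<bullet> (z - y))\<^sup>2)"
  define \<phi> where "\<phi> = (\<lambda>z. W z + B z)"
  have M: "0 \<le> M" using uM[of 0] by linarith
  have A: "0 \<le> A" using M by (simp add: A_def)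
  have B: "Ck 2 B" unfolding B_def by (intro Ck_cmult Ck_power Ck_norm_sq)
  have \<phi>: "Ck 2 \<phi>" unfolding \<phi>_def using W(1) B by (rule Ck_add)
  have "continuous_on (cball y r) (\<lambda>z. u z - \<phi> z)"
    using u(2) Ck_continuous[OF \<phi>] by (intro continuous_on_diff) (auto intro: continuous_on_subset)
  then obtain z where z: "z \<in> cball y r" and max: "\<And>w. w \<in> cball y r \<Longrightarrow> u w - \<phi> w \<le> u z - \<phi> z"
    using continuous_attains_sup[of "cball y r" "\<lambda>z. u z - \<phi> z"] r by auto
  have "u z - \<phi> z \<le> A * K / \<alpha>\<^sup>2 + \<eta> + e / \<alpha>"
  proof (cases "norm (z - y) < r")
    case False
    then have "norm (z - y) = r" using z by (simp add: dist_norm norm_minus_commute)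
    \<comment> \<open>on the sphere the barrier equals an upper bound of \<open>u - W\<close>\<close>
    then have "B z = 2 * M" unfolding B_def A_def using r by (simp add: dot_square_norm flip: power_mult)
    then have "u z - \<phi> z \<le> 0" using uM[of z] W(2)[of z] unfolding \<phi>_def by linarith
    moreover have "0 \<le> A * K / \<alpha>\<^sup>2 + \<eta> + e / \<alpha>" using A e \<alpha> by (simp add: K_def)
    ultimately show ?thesis by linarith
  next
    case True
    then have "z \<in> ball y r" by (simp add: dist_norm norm_minus_commute)
    then have "\<forall>\<^sub>F w in nhds z. w \<in> ball y r" using open_ball by (rule eventually_nhds_in_open[rotated])
    then have "\<forall>\<^sub>F w in nhds z. u w - \<phi> w \<le> u z - \<phi> z"
      by eventually_elim (use max in auto)
    then have "0 \<le> heat_op c \<phi> z" using u(1) \<phi> G z unfolding heat_subsolution_def by blast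
    also have "\<dots> = heat_op c W z + heat_op c B z" unfolding \<phi>_def by (rule heat_op_add[OF W(1) B])
    also have "\<dots> \<le> (\<alpha> * (W z - f z) + e) + \<alpha> * (B z + A * K / \<alpha>\<^sup>2)"
      unfolding B_def K_def using True r by (intro add_mono W quartic_barrier c A \<alpha>) simp
    also have "\<dots> = \<alpha> * (\<phi> z - f z + A * K / \<alpha>\<^sup>2 + e / \<alpha>)"
      unfolding \<phi>_def using \<alpha> by (simp add: algebra_simps)
    finally have "0 \<le> \<phi> z - f z + A * K / \<alpha>\<^sup>2 + e / \<alpha>" using \<alpha> by (simp add: zero_le_mult_iff)
    then show ?thesis using f[of z] by linarith
  qed
  moreover have "u y - \<phi> y \<le> u z - \<phi> z" using r by (intro max) simp
  moreover have "\<phi> y = W y" by (simp add: \<phi>_def B_def)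
  ultimately show ?thesis unfolding A_def[symmetric] K_def[symmetric] by linarith
qed

lemma mollified_subsolution:
  fixes u :: "'x::euclidean_space \<times> real \<Rightarrow> real"
  assumes u: "heat_subsolution c G u" "continuous_on UNIV u" "cpt_supp u"
    and c: "0 \<le> c" and r: "0 < r" "r \<le> 1" and G: "cball z (r + \<rho>) \<subseteq> G"
    and \<kappa>: "Ck 4 \<kappa>" "\<And>w. 0 \<le> \<kappa> w" "\<And>w. \<rho> < norm w \<Longrightarrow> \<kappa> w = 0" "integral UNIV \<kappa> = 1"
  shows "0 \<le> heat_op c (conv \<kappa> u) z"
proof -
  have \<kappa>c: "continuous_on UNIV \<kappa>" using \<kappa>(1) by (rule Ck_continuous)
  have \<kappa>s: "cpt_supp \<kappa>" using \<kappa>(3) unfolding cpt_supp_def by blast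
  define U where "U = conv \<kappa> u"
  define g where "g = heat_op c U"
  have U: "Ck 4 U" "cpt_supp U" unfolding U_def
    using conv_Ck[OF \<kappa>(1) \<kappa>s u(2,3)] conv_cpt_supp[OF \<kappa>c \<kappa>s u(3)] by auto
  have U2: "Ck 2 U" using U(1) by (rule Ck_le) simp
  have g: "Ck 2 g" "cpt_supp g" unfolding g_def
    using U by (auto intro!: Ck_heat_op cpt_supp_heat_op simp: eval_nat_numeral)
  obtain M where M: "M > 0" "\<And>z. \<bar>u z\<bar> \<le> M" using cpt_supp_bounded[OF u(3,2)] by blast
  have UM: "\<bar>U z\<bar> \<le> M" for z unfolding U_def using conv_bound[OF \<kappa>c \<kappa>s \<kappa>(2,4) u(2)] M by blast
  obtain m1 where m1: "m1 > 0" "\<And>z. \<bar>g z\<bar> \<le> m1"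
    using cpt_supp_bounded[OF g(2) Ck_continuous[OF g(1)]] by blast
  have Ag: "continuous_on UNIV (heat_op c g)"
    using g(1) by (intro Ck_continuous[of 0] Ck_heat_op) (simp add: numeral_2_eq_2)
  obtain m2 where m2: "m2 > 0" "\<And>z. \<bar>heat_op c g z\<bar> \<le> m2"
    using cpt_supp_bounded[OF cpt_supp_heat_op[OF g(2)] Ag] by blast
  define D where "D = (2 * M / r ^ 4) * ((8 + 4 * real DIM('x) + 4 * c)\<^sup>2 / 4)"
  have D: "0 \<le> D" using M r by (simp add: D_def)
  define C where "C = m2 + 1 + m1 + 2 * (1 + M) + D + 2"
  have C: "0 < C" using M m1 m2 D unfolding C_def by simp
  have key: "0 \<le> g z + C / \<alpha>" if \<alpha>1: "1 \<le> \<alpha>" for \<alpha>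
  proof -
    have \<alpha>: "0 < \<alpha>" using \<alpha>1 by simp
    \<comment> \<open>the tolerance \<open>\<eta>\<close> is still \<open>O(\<alpha>\<^sup>-\<^sup>1)\<close> after multiplication by \<open>\<alpha>\<close>\<close>
    define \<eta> where "\<eta> = 1 / \<alpha>\<^sup>2"
    have \<eta>: "0 < \<eta>" "\<eta> \<le> 1 / \<alpha>" "\<alpha> * \<eta> = 1 / \<alpha>" "\<eta> \<le> 1"
      using \<alpha>1 by (auto simp: \<eta>_def power2_eq_square field_simps intro: mult_ge1_I)
    obtain d where d: "d > 0" "\<And>z v. norm v < d \<Longrightarrow> \<bar>u (z + v) - u z\<bar> \<le> \<eta>"
      using cpt_supp_close[OF u(3,2) \<eta>(1)] by blast
    have d2: "0 < d / 2" using d(1) by simp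
    obtain \<kappa>' :: "'x \<times> real \<Rightarrow> real" where \<kappa>': "Ck 2 \<kappa>'" "\<And>w. 0 \<le> \<kappa>' w" "\<And>w. d / 2 < norm w \<Longrightarrow> \<kappa>' w = 0" "integral UNIV \<kappa>' = 1"
      by (rule mollifier_exists[OF d2, of 2]) (rule that)
    have \<kappa>'c: "continuous_on UNIV \<kappa>'" using \<kappa>'(1) by (rule Ck_continuous)
    have \<kappa>'s: "cpt_supp \<kappa>'" using \<kappa>'(3) unfolding cpt_supp_def by blast
    define f where "f = conv \<kappa>' u"
    have f: "Ck 2 f" "cpt_supp f" unfolding f_def
      using conv_Ck[OF \<kappa>'(1) \<kappa>'s u(2,3)] conv_cpt_supp[OF \<kappa>'c \<kappa>'s u(3)] by auto
    have fM: "\<bar>f z\<bar> \<le> M" for z unfolding f_def using conv_bound[OF \<kappa>'c \<kappa>'s \<kappa>'(2,4) u(2)] M by blast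
    have fu: "\<bar>f z - u z\<bar> \<le> \<eta>" for z
      unfolding f_def using d(2)[of "- _" z] d(1)
      by (intro conv_approx[where r = "d / 2", OF \<kappa>'c \<kappa>'s \<kappa>'(2,3,4) u(2)]) auto
    obtain h1 where h1: "h1 > 0" "\<And>h z. \<lbrakk>0 < h; h < h1\<rbrakk> \<Longrightarrow> \<bar>heat_diff c h f z - heat_op c f z\<bar> \<le> \<eta>"
      using heat_diff_consistent[OF f c \<eta>(1)] by blast
    obtain h2 where h2: "h2 > 0" "\<And>h z. \<lbrakk>0 < h; h < h2\<rbrakk> \<Longrightarrow> \<bar>heat_diff c h U z - heat_op c U z\<bar> \<le> \<eta>"
      using heat_diff_consistent[OF U2 U(2) c \<eta>(1)] by blast
    obtain h3 where h3: "h3 > 0" "\<And>h z. \<lbrakk>0 < h; h < h3\<rbrakk> \<Longrightarrow> \<bar>heat_diff c h g z - heat_op c g z\<bar> \<le> 1"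
      using heat_diff_consistent[OF g c zero_less_one] by blast
    define h where "h = min h1 (min h2 h3) / 2"
    have h: "0 < h" "h < h1" "h < h2" "h < h3" using h1(1) h2(1) h3(1) by (auto simp: h_def)
    obtain R :: "('x \<times> real \<Rightarrow> real) \<Rightarrow> 'x \<times> real \<Rightarrow> real" and w where R: "transl_comb w R" "w \<le> 1"
      and "\<forall>g m z. (\<forall>z. \<bar>g z\<bar> \<le> m) \<longrightarrow> \<bar>\<alpha> * R g z - heat_diff c h (R g) z - \<alpha> * g z\<bar> \<le> \<eta> * m"
      using heat_resolvent[OF c h(1) \<alpha> \<eta>(1)] by blast
    then have res: "\<bar>\<alpha> * R g z - heat_diff c h (R g) z - \<alpha> * g z\<bar> \<le> \<eta> * m" if "\<And>z. \<bar>g z\<bar> \<le> m" for g m z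
      using that by blast
    have Rclose: "R p z \<le> R q z + a" if "\<And>z. \<bar>p z - q z\<bar> \<le> a" for p q a z
    proof -
      have "\<bar>R (\<lambda>z. p z - q z) z\<bar> \<le> a" using R that by (rule transl_comb_bound_le1)
      moreover have "R (\<lambda>z. p z - q z) z = R p z - R q z" using R(1) by (rule transl_comb_diff)
      ultimately show ?thesis by linarith
    qed
    have W: "heat_op c (R f) z \<le> \<alpha> * (R f z - f z) + \<eta> * (1 + M)" for z
    proof -
      have "heat_op c (R f) z = R (heat_op c f) z" using R(1) f(1) by (rule transl_comb_heat_op)
      also have "\<dots> \<le> R (heat_diff c h f) z + \<eta>"
        using h1(2)[OF h(1,2)] by (intro Rclose) (simp add: abs_minus_commute)
      also have "R (heat_diff c h f) z = heat_diff c h (R f) z" using transl_comb_heat_diff[OF R(1) c h(1)] by simp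
      finally show ?thesis using res[of f M z] fM by (simp add: algebra_simps abs_le_iff)
    qed
    \<comment> \<open>the inequality \<open>u \<le> R u + P\<close> holds at the centre of every ball of radius \<open>r\<close> contained in \<open>G\<close>\<close>
    define P where "P = D / \<alpha>\<^sup>2 + 2 * \<eta> + \<eta> * (1 + M) / \<alpha>"
    have sub: "u y \<le> R u y + P" if "cball y r \<subseteq> G" for y
    proof -
      have "u y \<le> R f y + D / \<alpha>\<^sup>2 + \<eta> + \<eta> * (1 + M) / \<alpha>"
        unfolding D_def
      proof (rule resolvent_comparison[OF u(1,2) M(2) that r c \<alpha> transl_comb_Ck[OF R(1) f(1)] _ W])
        show "\<bar>R f z\<bar> \<le> M" for z using transl_comb_bound_le1[OF R fM] .
        show "u z \<le> f z + \<eta>" for z using fu[of z] by (simp add: abs_le_iff)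
      qed (use \<eta> M in auto)
      moreover have "R f y \<le> R u y + \<eta>" using fu by (rule Rclose)
      ultimately show ?thesis unfolding P_def by linarith
    qed
    have Ru: "continuous_on UNIV (R u)" using transl_comb_continuous[OF \<kappa>c \<kappa>s R(1) u(2)] .
    \<comment> \<open>averaging keeps the inequality and commutes with \<open>R\<close>\<close>
    have "U z \<le> conv \<kappa> (\<lambda>y. R u y + P) z"
      unfolding U_def
    proof (rule conv_mono[where r = \<rho>, OF \<kappa>c \<kappa>s \<kappa>(2,3) u(2)])
      show "continuous_on UNIV (\<lambda>y. R u y + P)" using Ru by (intro continuous_intros)
      fix w :: "'x \<times> real" assume w: "norm w \<le> \<rho>"
      have "cball (z - w) r \<subseteq> cball z (r + \<rho>)"
      proof
        fix v assume "v \<in> cball (z - w) r"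
        then have "norm (z - w - v) \<le> r" by (simp add: dist_norm)
        moreover have "z - v = (z - w - v) + w" by simp
        ultimately have "norm (z - v) \<le> r + \<rho>" using w norm_triangle_ineq[of "z - w - v" w] by simp
        then show "v \<in> cball z (r + \<rho>)" by (simp add: dist_norm)
      qed
      then show "u (z - w) \<le> R u (z - w) + P" using G by (intro sub) blast
    qed
    also have "\<dots> = conv \<kappa> (R u) z + conv \<kappa> (\<lambda>y. P) z"
      using Ru by (intro conv_add[OF \<kappa>c \<kappa>s]) auto
    also have "\<dots> = R U z + P"
      unfolding U_def by (simp add: transl_comb_conv[OF \<kappa>c \<kappa>s R(1) u(2)] conv_const[OF \<kappa>c \<kappa>s] \<kappa>(4))
    finally have "\<alpha> * U z \<le> \<alpha> * (R U z + P)" using \<alpha> by simp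
    then have 1: "\<alpha> * U z \<le> \<alpha> * R U z + \<alpha> * P" by (simp add: distrib_left)
    \<comment> \<open>expansion of \<open>R\<close> on the smooth functions \<open>U\<close> and \<open>g = L U\<close>\<close>
    have 2: "\<alpha> * R U z - \<alpha> * U z \<le> heat_diff c h (R U) z + \<eta> * M"
      using res[of U M z] UM by (simp add: abs_le_iff)
    have "heat_diff c h (R U) z = R (heat_diff c h U) z" using transl_comb_heat_diff[OF R(1) c h(1)] .
    also have "\<dots> \<le> R g z + \<eta>"
      unfolding g_def using h2(2)[OF h(1,3)] by (rule Rclose)
    finally have 3: "heat_diff c h (R U) z \<le> R g z + \<eta>" .
    have 4: "\<alpha> * R g z - \<alpha> * g z \<le> heat_diff c h (R g) z + \<eta> * m1"
      using res[of g m1 z] m1 by (simp add: abs_le_iff)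
    have "heat_diff c h (R g) z = R (heat_diff c h g) z" using transl_comb_heat_diff[OF R(1) c h(1)] .
    also have "\<dots> \<le> R (heat_op c g) z + 1"
      using h3(2)[OF h(1,4)] by (rule Rclose)
    also have "R (heat_op c g) z \<le> m2"
    proof -
      have "\<bar>R (heat_op c g) z\<bar> \<le> m2" using R m2(2) by (rule transl_comb_bound_le1)
      then show ?thesis by linarith
    qed
    finally have "heat_diff c h (R g) z \<le> m2 + 1" by simp
    moreover have "\<eta> * m1 \<le> 1 * m1" using \<eta>(4) m1(1) by (intro mult_right_mono) auto
    ultimately have "\<alpha> * R g z - \<alpha> * g z \<le> m2 + 1 + m1" using 4 by linarith
    then have 5: "R g z \<le> g z + (m2 + 1 + m1) / \<alpha>" using \<alpha> by (simp add: field_simps)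
    have "\<alpha> * P = D / \<alpha> + 2 * (\<alpha> * \<eta>) + \<eta> * (1 + M)"
      unfolding P_def using \<alpha> by (simp add: field_simps power2_eq_square)
    also have "\<dots> = D / \<alpha> + 2 / \<alpha> + \<eta> * (1 + M)" by (simp add: \<eta>(3))
    finally have "0 \<le> g z + (m2 + 1 + m1) / \<alpha> + D / \<alpha> + 2 / \<alpha> + 2 * (\<eta> * (1 + M))"
      using 1 2 3 5 by (simp add: algebra_simps)
    also have "\<dots> \<le> g z + (m2 + 1 + m1) / \<alpha> + D / \<alpha> + 2 / \<alpha> + 2 * (1 / \<alpha> * (1 + M))"
      using \<eta>(2) M by (intro add_mono mult_left_mono mult_right_mono) auto
    also have "\<dots> = g z + C / \<alpha>" unfolding C_def by (simp add: add_divide_distrib)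
    finally show ?thesis .
  qed
  have "0 \<le> g z"
  proof (rule field_le_epsilon)
    fix e :: real assume e: "0 < e"
    define \<alpha> where "\<alpha> = max 1 (C / e)"
    have "C / \<alpha> \<le> e"
    proof -
      have "C / e \<le> \<alpha>" "0 < \<alpha>" by (simp_all add: \<alpha>_def)
      then show ?thesis using e by (simp add: field_simps)
    qed
    moreover have "0 \<le> g z + C / \<alpha>" by (rule key) (simp add: \<alpha>_def)
    ultimately show "0 \<le> g z + e" by linarith
  qed
  then show ?thesis unfolding g_def U_def .
qed

section \<open>Comparison principle and monotonicity in the parameters\<close>

lemma heat_subsolution_of_viscosity:
  assumes u: "viscosity_subsolution \<Omega> bm bp u" and b: "bm \<le> bp" "c \<in> {bm, bp}"
  shows "heat_subsolution c (\<Omega> \<times> {0<..}) u"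
  unfolding heat_subsolution_def
proof (intro allI impI; elim conjE)
  fix \<phi> :: "'a \<times> real \<Rightarrow> real" and z :: "'a \<times> real"
  assume \<phi>: "Ck 2 \<phi>" and z: "z \<in> \<Omega> \<times> {0<..}" and max: "\<forall>\<^sub>F w in nhds z. u w - \<phi> w \<le> u z - \<phi> z"
  define p where "p = pd (0, 1) \<phi> z"
  have "b_coeff bm bp p * p \<le> xlap \<phi> z"
    unfolding p_def using subsolution_test_C2[OF u \<phi>, of "fst z" "snd z"] z max by (auto simp: mem_Times_iff)
  moreover have "c * p \<le> b_coeff bm bp p * p"
    using b by (auto simp: b_coeff_def mult_right_mono mult_right_mono_neg)
  ultimately show "0 \<le> heat_op c \<phi> z" unfolding heat_op_def p_def by linarith
qed

lemma heat_subsolution_cong: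
  assumes "heat_subsolution c G u" "open G'" "G' \<subseteq> G" "\<And>z. z \<in> G' \<Longrightarrow> u' z = u z"
  shows "heat_subsolution c G' u'"
  unfolding heat_subsolution_def
proof (intro allI impI; elim conjE)
  fix \<phi> :: "'a \<times> real \<Rightarrow> real" and z :: "'a \<times> real"
  assume \<phi>: "Ck 2 \<phi>" and z: "z \<in> G'" and max: "\<forall>\<^sub>F w in nhds z. u' w - \<phi> w \<le> u' z - \<phi> z"
  have "\<forall>\<^sub>F w in nhds z. w \<in> G'" using assms(2) z by (rule eventually_nhds_in_open)
  with max have "\<forall>\<^sub>F w in nhds z. u w - \<phi> w \<le> u z - \<phi> z"
    by eventually_elim (use assms(4) z in auto)
  then show "0 \<le> heat_op c \<phi> z" using assms(1,3) \<phi> z unfolding heat_subsolution_def by blast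
qed

lemma compact_neighbourhood:
  fixes K :: "'a::euclidean_space set"
  assumes "compact K" "K \<noteq> {}" "open G" "K \<subseteq> G"
  obtains K' e where "compact K'" "K' \<subseteq> G" "0 < e" "\<And>z. z \<in> K \<Longrightarrow> cball z e \<subseteq> K'"
proof -
  obtain e where e: "e > 0" "(\<Union>x\<in>K. cball x e) \<subseteq> G"
    using compact_subset_open_imp_cball_epsilon_subset[OF assms(1,3,4)] by blast
  define K' where "K' = {z. infdist z K \<le> e}"
  have "compact K'" unfolding K'_def using assms e by (intro compact_infdist_le) auto
  moreover have "K' \<subseteq> G"
  proof
    fix z assume "z \<in> K'"
    then have "infdist z K \<le> e" by (simp add: K'_def)
    moreover obtain y where "y \<in> K" "infdist z K = dist z y"
      using infdist_attains_inf[OF compact_imp_closed[OF assms(1)] assms(2)] by metis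
    ultimately have "z \<in> cball y e" "y \<in> K" by (auto simp: dist_commute)
    then show "z \<in> G" using e by blast
  qed
  moreover have "cball z e \<subseteq> K'" if "z \<in> K" for z
    unfolding K'_def using infdist_le2[OF that] by (auto simp: dist_commute)
  ultimately show ?thesis using that e(1) by blast
qed

lemma compactly_supported_extension:
  fixes u :: "'a::euclidean_space \<Rightarrow> real"
  assumes K: "compact K" and u: "continuous_on K u"
  obtains u' where "continuous_on UNIV u'" "cpt_supp u'" "\<And>z. z \<in> K \<Longrightarrow> u' z = u z"
proof (cases "K = {}")
  case True
  then show ?thesis using that[of "\<lambda>z. 0"] by (auto simp: cpt_supp_def)
next
  case False
  have "bounded (u ` K)" using K u by (intro compact_imp_bounded compact_continuous_image)
  then obtain B where B: "B > 0" "\<And>z. z \<in> K \<Longrightarrow> \<bar>u z\<bar> \<le> B" unfolding bounded_pos by auto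
  have cl: "closedin (top_of_set UNIV) K" using K by (simp add: compact_imp_closed)
  obtain g where g: "continuous_on UNIV g" "\<And>z. z \<in> K \<Longrightarrow> g z = u z"
    by (rule Tietze[OF u cl, of B]) (use B that in auto)
  define u' where "u' = (\<lambda>z. max 0 (1 - infdist z K) * g z)"
  have "continuous_on UNIV u'"
    unfolding u'_def using g(1) by (intro continuous_intros)
  moreover have "cpt_supp u'"
  proof -
    obtain r where r: "\<And>y. y \<in> K \<Longrightarrow> norm y \<le> r"
      using compact_imp_bounded[OF K] unfolding bounded_iff by blast
    have "u' z = 0" if z: "r + 1 < norm z" for z
    proof -
      obtain y where y: "y \<in> K" "infdist z K = dist z y"
        using infdist_attains_inf[OF compact_imp_closed[OF K] False] by metis
      have "1 \<le> dist z y" using r[OF y(1)] z norm_triangle_ineq2[of z y] by (simp add: dist_norm)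
      then show ?thesis unfolding u'_def using y by simp
    qed
    then show ?thesis unfolding cpt_supp_def by blast
  qed
  moreover have "u' z = u z" if "z \<in> K" for z using that g by (simp add: u'_def)
  ultimately show ?thesis by (rule that)
qed

text \<open>
  The approximation \<open>U\<close> does not depend on the coefficient \<open>c\<close>, so it is a classical subsolution for all coefficients
  in \<open>I\<close> at once.
\<close>

lemma smooth_subsolution_approximation:
  fixes u :: "'x::euclidean_space \<times> real \<Rightarrow> real"
  assumes u: "\<And>c. c \<in> I \<Longrightarrow> heat_subsolution c G u" and I: "\<And>c. c \<in> I \<Longrightarrow> 0 \<le> c"
    and uc: "continuous_on G u" and G: "open G" and K: "compact K" "K \<subseteq> G" and \<epsilon>: "0 < \<epsilon>"
  shows "\<exists>U. Ck 2 U \<and> (\<forall>z\<in>K. \<bar>U z - u z\<bar> \<le> \<epsilon> \<and> (\<forall>c\<in>I. 0 \<le> heat_op c U z))"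
proof (cases "K = {}")
  case True
  then show ?thesis by (intro exI[of _ "\<lambda>z. 0"]) simp
next
  case False
  obtain K' e where K': "compact K'" "K' \<subseteq> G" "0 < e" "\<And>z. z \<in> K \<Longrightarrow> cball z e \<subseteq> K'"
    using compact_neighbourhood[OF K(1) False G K(2)] by blast
  obtain u' where u': "continuous_on UNIV u'" "cpt_supp u'" "\<And>z. z \<in> K' \<Longrightarrow> u' z = u z"
    using compactly_supported_extension[OF K'(1) continuous_on_subset[OF uc K'(2)]] by blast
  have sub: "heat_subsolution c (interior K') u'" if "c \<in> I" for c
    using interior_subset[of K'] K'(2) u'(3) by (intro heat_subsolution_cong[OF u[OF that]]) auto
  obtain d where d: "d > 0" "\<And>z v. norm v < d \<Longrightarrow> \<bar>u' (z + v) - u' z\<bar> \<le> \<epsilon>"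
    using cpt_supp_close[OF u'(2,1) \<epsilon>] by blast
  define \<rho> where "\<rho> = min d e / 2"
  have \<rho>: "0 < \<rho>" "\<rho> < d" "\<rho> \<le> e / 2" using d(1) K'(3) by (auto simp: \<rho>_def)
  define r where "r = min 1 (e / 4)"
  have r: "0 < r" "r \<le> 1" "r + \<rho> < e" using K'(3) \<rho> by (auto simp: r_def)
  obtain \<kappa> :: "'x \<times> real \<Rightarrow> real" where \<kappa>: "Ck 4 \<kappa>" "\<And>w. 0 \<le> \<kappa> w" "\<And>w. \<rho> < norm w \<Longrightarrow> \<kappa> w = 0" "integral UNIV \<kappa> = 1"
    by (rule mollifier_exists[OF \<rho>(1), of 4]) (rule that)
  have \<kappa>c: "continuous_on UNIV \<kappa>" using \<kappa>(1) by (rule Ck_continuous)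
  have \<kappa>s: "cpt_supp \<kappa>" using \<kappa>(3) unfolding cpt_supp_def by blast
  have "Ck 2 (conv \<kappa> u')" using conv_Ck[OF \<kappa>(1) \<kappa>s u'(1,2)] by (rule Ck_le) simp
  moreover have "\<bar>conv \<kappa> u' z - u z\<bar> \<le> \<epsilon>" if z: "z \<in> K" for z
  proof -
    have "\<bar>conv \<kappa> u' z - u' z\<bar> \<le> \<epsilon>"
      using d(2)[of "- _" z] \<rho> by (intro conv_approx[where r = \<rho>, OF \<kappa>c \<kappa>s \<kappa>(2,3,4) u'(1)]) auto
    moreover have "z \<in> K'" using K'(3) K'(4)[OF z] by auto
    ultimately show ?thesis using u'(3) by simp
  qed
  moreover have "0 \<le> heat_op c (conv \<kappa> u') z" if z: "z \<in> K" and c: "c \<in> I" for z c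
  proof -
    have "ball z e \<subseteq> interior K'" using K'(4)[OF z] by (intro interior_maximal) auto
    then have "cball z (r + \<rho>) \<subseteq> interior K'" using r(3) by (auto simp: subset_iff)
    then show ?thesis
      by (rule mollified_subsolution[OF sub[OF c] u'(1,2) I[OF c] r(1,2) _ \<kappa>])
  qed
  ultimately show ?thesis by blast
qed

text \<open>
  The functions need not vanish on the lateral boundary; it is enough that \<open>u \<le> v\<close> on the parabolic boundary.
\<close>

lemma comparison_principle:
  fixes \<Omega> :: "'x::euclidean_space set"
  assumes \<Omega>: "open \<Omega>" "bounded \<Omega>" and b: "0 < bm" "bm \<le> bp"
    and u: "continuous_on (closure \<Omega> \<times> {0..}) u" "viscosity_subsolution \<Omega> bm bp u"
    and v: "continuous_on (closure \<Omega> \<times> {0..}) v" "viscosity_supersolution \<Omega> bm bp v"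
    and lateral: "\<And>x t. x \<in> frontier \<Omega> \<Longrightarrow> 0 \<le> t \<Longrightarrow> u (x, t) \<le> v (x, t)"
    and initial: "\<And>x. x \<in> \<Omega> \<Longrightarrow> u (x, 0) \<le> v (x, 0)"
    and x: "x \<in> closure \<Omega>" and t: "0 \<le> t"
  shows "u (x, t) \<le> v (x, t)"
proof (rule ccontr)
  assume "\<not> u (x, t) \<le> v (x, t)"
  define \<theta> where "\<theta> = (u (x, t) - v (x, t)) / 4"
  have \<theta>: "0 < \<theta>" using \<open>\<not> u (x, t) \<le> v (x, t)\<close> by (simp add: \<theta>_def)
  have diff: "u (x, t) - v (x, t) = 4 * \<theta>" by (simp add: \<theta>_def)
  define T where "T = t + 1"
  have T: "0 < T" "t < T" using t by (auto simp: T_def)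
  define Q where "Q = closure \<Omega> \<times> {0..T}"
  have Q: "compact Q" unfolding Q_def using \<Omega> by (intro compact_Times) auto
  have Qsub: "Q \<subseteq> closure \<Omega> \<times> {0..}" unfolding Q_def by auto
  have uvQ: "continuous_on Q u" "continuous_on Q v" using u(1) v(1) Qsub by (auto intro: continuous_on_subset)
  then have "bounded ((\<lambda>z. u z - v z) ` Q)"
    using Q by (intro compact_imp_bounded compact_continuous_image continuous_on_diff)
  then obtain M where M: "M > 0" "\<And>z. z \<in> Q \<Longrightarrow> \<bar>u z - v z\<bar> \<le> M" unfolding bounded_pos by auto
  have "t / T < 1" "0 \<le> t / T" using T t by simp_all
  then obtain m where m: "(t / T) ^ m < \<theta> / M"
    using real_arch_pow_inv[of "\<theta> / M" "t / T"] \<theta> M by auto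
  \<comment> \<open>\<open>\<psi>\<close> is at most \<open>2 \<theta>\<close> at time \<open>t\<close> but at least \<open>M\<close> at time \<open>T\<close>, which keeps maxima away from the final time\<close>
  define \<psi> where "\<psi> = (\<lambda>z :: 'x \<times> real. \<theta> / T * (z \<bullet> (0, 1)) + M / T ^ m * (z \<bullet> (0, 1)) ^ m)"
  have \<psi>: "\<psi> (y, s) = \<theta> * (s / T) + M * (s / T) ^ m" for y s
    by (simp add: \<psi>_def power_divide)
  have \<psi>Ck: "Ck 2 \<psi>" unfolding \<psi>_def by (intro Ck_add Ck_cmult Ck_power Ck_inner)
  have \<psi>0: "0 \<le> \<psi> (y, s)" if "0 \<le> s" for y s using that \<theta> M T by (simp add: \<psi>)
  have "\<theta> * (t / T) \<le> \<theta> * 1" using \<theta> T t by (intro mult_left_mono) auto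
  moreover have "M * (t / T) ^ m \<le> \<theta>" using m M by (simp add: field_simps)
  ultimately have \<psi>t: "\<psi> (x, t) \<le> 2 * \<theta>" by (simp add: \<psi>)
  have \<psi>T: "M \<le> \<psi> (y, T)" for y using T \<theta> by (simp add: \<psi>)
  define K where "K = Q \<inter> (\<lambda>z. u z - v z - \<psi> z) -` {\<theta>..}"
  have "continuous_on Q (\<lambda>z. u z - v z - \<psi> z)"
    using uvQ Ck_continuous[OF \<psi>Ck] by (intro continuous_on_diff) (auto intro: continuous_on_subset)
  then have "closed K" unfolding K_def using Q by (intro continuous_closed_preimage) (auto intro: compact_imp_closed)
  then have K: "compact K" using Q unfolding K_def by (metis Int_lower1 bounded_subset compact_eq_bounded_closed)
  have "(x, t) \<in> Q" using x t T by (simp add: Q_def)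
  then have xK: "(x, t) \<in> K" using \<psi>t \<theta> by (simp add: K_def \<theta>_def)
  define G where "G = \<Omega> \<times> {0<..<T}"
  have G: "open G" unfolding G_def using \<Omega> by (intro open_Times) auto
  have KG: "K \<subseteq> G"
  proof
    fix z assume "z \<in> K"
    then obtain y s where z: "z = (y, s)" "y \<in> closure \<Omega>" "0 \<le> s" "s \<le> T" "(y, s) \<in> Q"
      and pos: "\<theta> \<le> u (y, s) - v (y, s) - \<psi> (y, s)"
      unfolding K_def Q_def by auto
    have less: "v (y, s) < u (y, s)" using pos \<theta> \<psi>0[OF z(3)] by (smt (verit))
    then have "y \<in> \<Omega>" using lateral[of y s] z closure_Un_frontier[of \<Omega>] by auto
    moreover have "s \<noteq> 0" using less initial[of y] \<open>y \<in> \<Omega>\<close> by auto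
    moreover have "s \<noteq> T" using pos \<psi>T[of y] M(2)[OF z(5)] \<theta> by (auto simp: abs_le_iff)
    ultimately show "z \<in> G" using z by (simp add: G_def)
  qed
  obtain K' e where K': "compact K'" "K' \<subseteq> G" "0 < e" "\<And>z. z \<in> K \<Longrightarrow> cball z e \<subseteq> K'"
    using compact_neighbourhood[OF K _ G KG] xK by blast
  have GQ: "G \<subseteq> Q" unfolding G_def Q_def using closure_subset[of \<Omega>] by auto
  have "\<exists>U. Ck 2 U \<and> (\<forall>z\<in>K'. \<bar>U z - u z\<bar> \<le> \<theta> / 4 \<and> (\<forall>c\<in>{bm, bp}. 0 \<le> heat_op c U z))"
  proof (rule smooth_subsolution_approximation[OF _ _ _ _ K'(1)])
    show "heat_subsolution c (\<Omega> \<times> {0<..}) u" if "c \<in> {bm, bp}" for c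
      using heat_subsolution_of_viscosity[OF u(2) b(2) that] .
    show "continuous_on (\<Omega> \<times> {0<..}) u"
      by (rule continuous_on_subset[OF u(1)]) (use closure_subset[of \<Omega>] in auto)
    show "open (\<Omega> \<times> {0::real<..})" using \<Omega> by (intro open_Times) auto
    show "K' \<subseteq> \<Omega> \<times> {0<..}" using K'(2) by (auto simp: G_def)
  qed (use b \<theta> in auto)
  then obtain U where U: "Ck 2 U" "\<And>z. z \<in> K' \<Longrightarrow> \<bar>U z - u z\<bar> \<le> \<theta> / 4"
    "\<And>z c. z \<in> K' \<Longrightarrow> c \<in> {bm, bp} \<Longrightarrow> 0 \<le> heat_op c U z" by blast
  define \<phi> where "\<phi> = (\<lambda>z. U z + (-1) * \<psi> z)"
  have \<phi>: "Ck 2 \<phi>" unfolding \<phi>_def using U(1) \<psi>Ck by (intro Ck_add Ck_cmult)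
  have xK': "(x, t) \<in> K'" using K'(3) K'(4)[OF xK] by auto
  have "continuous_on K' (\<lambda>z. \<phi> z - v z)"
    using uvQ(2) K'(2) GQ Ck_continuous[OF \<phi>] by (intro continuous_on_diff) (auto intro: continuous_on_subset)
  then obtain z where z: "z \<in> K'" and max: "\<And>w. w \<in> K' \<Longrightarrow> \<phi> w - v w \<le> \<phi> z - v z"
    using continuous_attains_sup[OF K'(1)] xK' by blast
  have "2 * \<theta> - \<theta> / 4 \<le> \<phi> (x, t) - v (x, t)"
    using U(2)[OF xK'] \<psi>t diff unfolding \<phi>_def by linarith
  also have "\<dots> \<le> \<phi> z - v z" using xK' by (rule max)
  also have "\<dots> \<le> u z - v z - \<psi> z + \<theta> / 4" using U(2)[OF z] unfolding \<phi>_def by linarith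
  finally have "\<theta> \<le> u z - v z - \<psi> z" using \<theta> by simp
  \<comment> \<open>the maximum over \<open>K'\<close> is attained in \<open>K\<close>, hence in the interior of \<open>K'\<close>\<close>
  then have zK: "z \<in> K" using z K'(2) GQ by (auto simp: K_def)
  have "z \<in> ball z e" using K'(3) by simp
  then have "\<forall>\<^sub>F w in nhds z. w \<in> ball z e" using open_ball by (rule eventually_nhds_in_open[rotated])
  then have ev: "\<forall>\<^sub>F w in nhds z. v w - \<phi> w \<ge> v z - \<phi> z"
  proof eventually_elim
    case (elim w)
    then have "w \<in> K'" using K'(4)[OF zK] by auto
    from max[OF this] show ?case by linarith
  qed
  have zG: "fst z \<in> \<Omega>" "0 < snd z" using zK KG unfolding G_def by (auto simp: mem_Times_iff)
  define p where "p = pd (0, 1) \<phi> z"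
  have "xlap \<phi> z \<le> b_coeff bm bp p * p"
    unfolding p_def using supersolution_test_C2[OF v(2) \<phi> zG] ev by simp
  moreover have "0 < heat_op (b_coeff bm bp p) \<phi> z"
  proof -
    define c where "c = b_coeff bm bp p"
    have c: "c \<in> {bm, bp}" "0 < c" using b by (auto simp: c_def b_coeff_def)
    have pd\<psi>: "pd i \<psi> = (\<lambda>z. (\<theta> / T + M / T ^ m * (real m * (z \<bullet> (0, 1)) ^ (m - 1))) * (i \<bullet> (0, 1)))" for i
      unfolding \<psi>_def
      by (rule ext, rule pd_eqI[THEN trans], (rule derivative_eq_intros refl)+) (simp add: algebra_simps)
    have "pd (i, 0) \<psi> = (\<lambda>z. 0)" for i by (simp add: pd\<psi>)
    then have "xlap \<psi> z = 0" unfolding xlap_def by (simp add: pd_const)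
    moreover have "0 < pd (0, 1) \<psi> z"
      unfolding pd\<psi> using \<theta> T M zG(2) by (simp add: inner_prod_def add_pos_nonneg)
    ultimately have "heat_op c \<psi> z < 0" using c by (simp add: heat_op_def)
    moreover have "heat_op c \<phi> z = heat_op c U z + (-1) * heat_op c \<psi> z"
      unfolding \<phi>_def heat_op_add[OF U(1) Ck_cmult[OF \<psi>Ck]] heat_op_cmult[OF \<psi>Ck] ..
    ultimately show ?thesis using U(3)[OF z c(1)] unfolding c_def by linarith
  qed
  ultimately show False unfolding heat_op_def p_def by linarith
qed

lemma supersolution_mono:
  assumes v: "viscosity_supersolution \<Omega> bm bp v" and b: "bm' \<le> bm" "bp \<le> bp'"
  shows "viscosity_supersolution \<Omega> bm' bp' v"
  unfolding viscosity_supersolution_def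
proof (intro allI impI ballI)
  fix \<phi> :: "'a \<times> real \<Rightarrow> real" and x t
  assume "smooth_fun_on (\<Omega> \<times> {0<..}) \<phi>" "x \<in> \<Omega>" "0 < t" "\<forall>\<^sub>F z in nhds (x, t). v z - \<phi> z \<ge> v (x, t) - \<phi> (x, t)"
  then have "0 \<le> pde_operator bm bp \<phi> x t" using v unfolding viscosity_supersolution_def by blast
  moreover have "b_coeff bm bp s * s \<le> b_coeff bm' bp' s * s" for s
    using b by (auto simp: b_coeff_def mult_right_mono mult_right_mono_neg)
  ultimately show "0 \<le> pde_operator bm' bp' \<phi> x t" unfolding pde_operator_def by (smt (verit))
qed

text \<open>
  The boundary condition is imposed for positive times; at time \<open>0\<close> it follows by continuity.
\<close>

lemma viscosity_solution_lateral:
  assumes u: "viscosity_solution \<Omega> u0 bm bp u" and x: "x \<in> frontier \<Omega>" and t: "0 \<le> t"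
  shows "u (x, t) = 0"
proof (cases "t = 0")
  case False
  then show ?thesis using u x t by (simp add: viscosity_solution_def)
next
  case True
  define X where "X = (\<lambda>n. (x, 1 / real (Suc n)))"
  have xc: "x \<in> closure \<Omega>" using x by (simp add: frontier_def)
  have c: "continuous_on (closure \<Omega> \<times> {0..}) u" using u by (simp add: viscosity_solution_def)
  have "X \<longlonglongrightarrow> (x, 0)" unfolding X_def
    by (intro tendsto_Pair tendsto_const) (use LIMSEQ_inverse_real_of_nat in \<open>simp add: inverse_eq_divide\<close>)
  then have "(\<lambda>n. u (X n)) \<longlonglongrightarrow> u (x, 0)"
  proof (rule continuous_on_tendsto_compose[OF c])
    show "\<forall>\<^sub>F n in sequentially. X n \<in> closure \<Omega> \<times> {0..}" using xc by (simp add: X_def)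
  qed (use xc in simp)
  moreover have "u (X n) = 0" for n using u x by (simp add: X_def viscosity_solution_def)
  ultimately have "(\<lambda>n. 0) \<longlonglongrightarrow> u (x, 0)" by simp
  then show ?thesis using True LIMSEQ_const_iff by metis
qed

lemma viscosity_solution_comparison:
  assumes \<Omega>: "open \<Omega>" "bounded \<Omega>" and b: "0 < bm" "bm \<le> bp"
    and u: "viscosity_solution \<Omega> u0 bm1 bp1 u" "viscosity_subsolution \<Omega> bm bp u"
    and v: "viscosity_solution \<Omega> u0 bm2 bp2 v" "viscosity_supersolution \<Omega> bm bp v"
    and "x \<in> closure \<Omega>" "0 \<le> t"
  shows "u (x, t) \<le> v (x, t)"
proof (rule comparison_principle[OF \<Omega> b _ u(2) _ v(2)])
  show "u (x, t) \<le> v (x, t)" if "x \<in> frontier \<Omega>" "0 \<le> t" for x t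
    using viscosity_solution_lateral[OF u(1) that] viscosity_solution_lateral[OF v(1) that] by simp
qed (use assms in \<open>auto simp: viscosity_solution_def\<close>)

theorem proposition2p5:
  fixes \<Omega> :: "(real ^ 'n) set" and u0 :: "real ^ 'n \<Rightarrow> real" and bm bp :: real
  assumes "bounded_smooth_domain \<Omega>"
    and "continuous_on (closure \<Omega>) u0"
    and "\<forall>x\<in>frontier \<Omega>. u0 x = 0"
    and "0 < bm" and "bm < bp"
  shows "(\<forall>bm' u v. bm < bm' \<and> bm' < bp \<and>
             viscosity_solution \<Omega> u0 bm bp u \<and> viscosity_solution \<Omega> u0 bm' bp v \<longrightarrow>
             (\<forall>x\<in>closure \<Omega>. \<forall>t\<ge>0. u (x, t) \<le> v (x, t))) \<and>
         (\<forall>bp' u v. bp < bp' \<and>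
             viscosity_solution \<Omega> u0 bm bp u \<and> viscosity_solution \<Omega> u0 bm bp' v \<longrightarrow>
             (\<forall>x\<in>closure \<Omega>. \<forall>t\<ge>0. u (x, t) \<ge> v (x, t)))"
proof -
  have \<Omega>: "open \<Omega>" "bounded \<Omega>" using assms(1) by (auto simp: bounded_smooth_domain_def)
  show ?thesis
  proof (intro conjI allI impI ballI)
    fix bm' u v x and t :: real
    assume A: "bm < bm' \<and> bm' < bp \<and>
        viscosity_solution \<Omega> u0 bm bp u \<and> viscosity_solution \<Omega> u0 bm' bp v"
      and xt: "x \<in> closure \<Omega>" "0 \<le> t"
    from A have b: "bm < bm'" and u: "viscosity_solution \<Omega> u0 bm bp u"
      and v: "viscosity_solution \<Omega> u0 bm' bp v" by auto
    show "u (x, t) \<le> v (x, t)"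
    proof (rule viscosity_solution_comparison[OF \<Omega> assms(4) _ u _ v _ xt])
      have "viscosity_supersolution \<Omega> bm' bp v" using v by (simp add: viscosity_solution_def)
      then show "viscosity_supersolution \<Omega> bm bp v" by (rule supersolution_mono) (use b in auto)
      show "viscosity_subsolution \<Omega> bm bp u" using u by (simp add: viscosity_solution_def)
    qed (use assms(5) in simp)
  next
    fix bp' u v x and t :: real
    assume A: "bp < bp' \<and>
        viscosity_solution \<Omega> u0 bm bp u \<and> viscosity_solution \<Omega> u0 bm bp' v"
      and xt: "x \<in> closure \<Omega>" "0 \<le> t"
    from A have b: "bp < bp'" and u: "viscosity_solution \<Omega> u0 bm bp u"
      and v: "viscosity_solution \<Omega> u0 bm bp' v" by auto
    show "v (x, t) \<le> u (x, t)"
    proof (rule viscosity_solution_comparison[OF \<Omega> assms(4) _ v _ u _ xt])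
      have "viscosity_supersolution \<Omega> bm bp u" using u by (simp add: viscosity_solution_def)
      then show "viscosity_supersolution \<Omega> bm bp' u" by (rule supersolution_mono) (use b in auto)
      show "viscosity_subsolution \<Omega> bm bp' v" using v by (simp add: viscosity_solution_def)
    qed (use b assms(5) in simp)
  qed
qed

end
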